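(* Let $n>2$ and let $M^n$ be an $n$-dimensional CR submanifold of maximal CR dimension of the complex projective space $\mathbf{P}^{\frac{n+p}{2}}(\mathbf{C})$, with distinguished unit normal vector $\xi$. Let $\eta$ be an umbilical normal vector of $M^n$ (at a point $x\in M^n$). If the normal connection of $M^n$ is flat, then $\eta$ is in the direction of the distinguished normal vector $\xi$, i.e. $\eta\in\mathrm{span}\{\xi_x\}$.
   Context: All manifolds are smooth and nonempty. $\mathbf{P}^{\frac{n+p}{2}}(\mathbf{C})$ is the complex projective space of complex dimension $\frac{n+p}{2}$ with the Fubini–Study metric $\langle\cdot,\cdot\rangle$ of constant holomorphic sectional curvature $4$ and complex structure $J$. For an $n$-dimensional real submanifold $M^n$ (so of real codimension $p\geq 1$) and $x\in M^n$, the holomorphic tangent space is $H_x(M^n)=JT_x(M^n)\cap T_x(M^n)$. $M^n$ is a CR submanifold of maximal CR dimension if $\dim_{\mathbf{R}}H_x(M^n)=n-1$ for every $x\in M^n$ (so $n$ is odd). Then at each $x$ there is a unit normal vector $\xi_x$, unique up to sign, with $JT_x(M^n)\subset T_x(M^n)\oplus\mathrm{span}\{\xi_x\}$; it is called the distinguished normal vector. The normal connection $D$ is flat if its curvature tensor $R^{\perp}$ vanishes. Let $\zeta$ be the mean curvature vector ($\frac1n$ times the trace of the second fundamental form). For a normal vector $\eta$ at $x$, let $A_\eta$ be the shape operator with respect to $\eta$; $\eta$ is umbilical if $A_\eta=\lambda\,\mathrm{id}$ on $T_x(M^n)$, where $\lambda=\langle\eta,\zeta\rangle$. *)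

theory Defs
  imports "HOL-Analysis.Analysis"
begin

section \<open>Smooth maps and smooth manifolds\<close>

primrec k_times_diff_on :: "nat \<Rightarrow> 'a::real_normed_vector set \<Rightarrow> ('a \<Rightarrow> 'b::real_normed_vector) \<Rightarrow> bool" where
  "k_times_diff_on 0 S f \<longleftrightarrow> continuous_on S f"
| "k_times_diff_on (Suc k) S f \<longleftrightarrow>
     (\<forall>x\<in>S. f differentiable (at x)) \<and>
     (\<forall>v. k_times_diff_on k S (\<lambda>x. frechet_derivative f (at x) v))"

text \<open>Only used for open \<open>S\<close>.\<close>
definition smooth_on :: "'a::real_normed_vector set \<Rightarrow> ('a \<Rightarrow> 'b::real_normed_vector) \<Rightarrow> bool" where
  "smooth_on S f \<longleftrightarrow> (\<forall>k. k_times_diff_on k S f)"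

text \<open>A chart is a pair of its domain and its coordinate map.\<close>
type_synonym ('a, 'e) chart = "'a set \<times> ('a \<Rightarrow> 'e)"

definition coord_rep :: "('a, 'e) chart \<Rightarrow> ('b, 'f) chart \<Rightarrow> ('a \<Rightarrow> 'b) \<Rightarrow> 'e \<Rightarrow> 'f" where
  "coord_rep c d f = snd d \<circ> f \<circ> inv_into (fst c) (snd c)"

definition coord_dom :: "('a, 'e) chart \<Rightarrow> ('b, 'f) chart \<Rightarrow> ('a \<Rightarrow> 'b) \<Rightarrow> 'e set" where
  "coord_dom c d f = snd c ` {x \<in> fst c. f x \<in> fst d}"

text \<open>The coordinate representation of the identity in two charts is their transition map.\<close>
definition smooth_manifold :: "'a topology \<Rightarrow> ('a, 'e::euclidean_space) chart set \<Rightarrow> bool" where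
  "smooth_manifold M \<A> \<longleftrightarrow>
     topspace M \<noteq> {} \<and> Hausdorff_space M \<and> second_countable M \<and>
     (\<Union>c\<in>\<A>. fst c) = topspace M \<and>
     (\<forall>c\<in>\<A>. openin M (fst c) \<and> open (snd c ` fst c) \<and>
        homeomorphic_map (subtopology M (fst c)) (top_of_set (snd c ` fst c)) (snd c)) \<and>
     (\<forall>c\<in>\<A>. \<forall>d\<in>\<A>. smooth_on (coord_dom c d id) (coord_rep c d id))"

text \<open>Openness of the coordinate domains encodes continuity of the map with respect to the
  topology which the atlas \<open>\<B>\<close> induces on the target.\<close>
definition smooth_immersion ::
  "('a, 'e::euclidean_space) chart set \<Rightarrow> ('b, 'f::euclidean_space) chart set \<Rightarrow> ('a \<Rightarrow> 'b) \<Rightarrow> bool" where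
  "smooth_immersion \<A> \<B> f \<longleftrightarrow>
     f ` (\<Union>c\<in>\<A>. fst c) \<subseteq> (\<Union>d\<in>\<B>. fst d) \<and>
     (\<forall>c\<in>\<A>. \<forall>d\<in>\<B>. open (coord_dom c d f) \<and> smooth_on (coord_dom c d f) (coord_rep c d f) \<and>
        (\<forall>u\<in>coord_dom c d f. inj (frechet_derivative (coord_rep c d f) (at u))))"

section \<open>Complex projective space with the Fubini--Study metric\<close>

text \<open>With \<open>m = CARD('m)\<close>, the homogeneous coordinates live in \<open>complex ^ 'm option\<close>, a copy of the
  complex vector space of dimension \<open>m + 1\<close>; points are complex lines through the origin.\<close>

definition complex_line :: "complex ^ 'k \<Rightarrow> (complex ^ 'k) set" where
  "complex_line z = range (\<lambda>a. a *s z)"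

definition complex_projective_space :: "(complex ^ ('m::finite) option) set set" where
  "complex_projective_space = complex_line ` (- {0})"

text \<open>The affine chart \<open>j\<close> lives where \<open>z\<^sub>j \<noteq> 0\<close> and collects the quotients \<open>z\<^sub>k / z\<^sub>j\<close>, \<open>k \<noteq> j\<close>.  To
  index them by \<open>'m\<close> for every \<open>j\<close>, the quotient with \<open>k = None\<close> takes the vacant slot \<open>j\<close>.  The value
  does not depend on the representative \<open>z\<close>.\<close>
definition affine_chart :: "'m::finite option \<Rightarrow> ((complex ^ ('m::finite) option) set, complex ^ 'm) chart" where
  "affine_chart j =
     ({l \<in> complex_projective_space. \<exists>z\<in>l. z $ j \<noteq> 0},
      \<lambda>l. let z = (SOME z. z \<in> l \<and> z $ j \<noteq> 0)
          in \<chi> i. z $ (if Some i = j then None else Some i) / z $ j)"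

definition affine_atlas :: "((complex ^ ('m::finite) option) set, complex ^ 'm) chart set" where
  "affine_atlas = range affine_chart"

definition hermitian_inner :: "complex ^ 'm \<Rightarrow> complex ^ 'm \<Rightarrow> complex" where
  "hermitian_inner u v = (\<Sum>i\<in>UNIV. u $ i * cnj (v $ i))"

text \<open>The Fubini--Study metric at the point with affine coordinates \<open>w\<close>, the same expression in each
  affine chart.  In this normalisation the Hopf map from the unit sphere is a Riemannian submersion and
  the holomorphic sectional curvature is \<open>4\<close>: for \<open>m = 1\<close> it reads \<open>\<bar>dw\<bar>\<^sup>2 / (1 + \<bar>w\<bar>\<^sup>2)\<^sup>2\<close>,
  the round sphere of radius \<open>1/2\<close>.\<close>
definition fubini_study :: "complex ^ 'm \<Rightarrow> complex ^ 'm \<Rightarrow> complex ^ 'm \<Rightarrow> real" where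
  "fubini_study w u v =
     Re (of_real (1 + (norm w)\<^sup>2) * hermitian_inner u v - hermitian_inner u w * hermitian_inner w v)
       / (1 + (norm w)\<^sup>2)\<^sup>2"

text \<open>The affine charts are holomorphic, so the complex structure \<open>J\<close> is multiplication by \<open>\<i>\<close> in each
  of them.\<close>
definition cplx_struct :: "complex ^ 'm \<Rightarrow> complex ^ 'm" where
  "cplx_struct v = \<i> *s v"

section \<open>Riemannian geometry of an immersion in local coordinates\<close>

text \<open>Throughout, \<open>g w u v\<close> is a Riemannian metric in coordinates (base point \<open>w\<close>, tangent vectors \<open>u\<close>,
  \<open>v\<close>) and \<open>F\<close> is an immersion in coordinates.  Tangent vectors of the source and of the target are
  represented by their coordinate vectors.\<close>

text \<open>The Christoffel symbols of the Levi-Civita connection, by the Koszul formula for constant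
  coordinate vector fields.\<close>
definition christoffel :: "('e::euclidean_space \<Rightarrow> 'e \<Rightarrow> 'e \<Rightarrow> real) \<Rightarrow> 'e \<Rightarrow> 'e \<Rightarrow> 'e \<Rightarrow> 'e" where
  "christoffel g w u v =
     (THE t. \<forall>s. g w t s =
        (frechet_derivative (\<lambda>y. g y v s) (at w) u
         + frechet_derivative (\<lambda>y. g y u s) (at w) v
         - frechet_derivative (\<lambda>y. g y u v) (at w) s) / 2)"

text \<open>The ambient Levi-Civita derivative of a vector field \<open>V\<close> along \<open>F\<close> in the direction \<open>a\<close>.\<close>
definition cov_deriv ::
  "('e::euclidean_space \<Rightarrow> 'e \<Rightarrow> 'e \<Rightarrow> real) \<Rightarrow> (real ^ 'n \<Rightarrow> 'e) \<Rightarrow> real ^ 'n \<Rightarrow> (real ^ 'n \<Rightarrow> 'e) \<Rightarrow> real ^ 'n \<Rightarrow> 'e" where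
  "cov_deriv g F a V u =
     frechet_derivative V (at u) a + christoffel g (F u) (frechet_derivative F (at u) a) (V u)"

definition tangent_sp :: "(real ^ 'n \<Rightarrow> 'e::euclidean_space) \<Rightarrow> real ^ 'n \<Rightarrow> 'e set" where
  "tangent_sp F u = range (frechet_derivative F (at u))"

definition normal_sp ::
  "('e::euclidean_space \<Rightarrow> 'e \<Rightarrow> 'e \<Rightarrow> real) \<Rightarrow> (real ^ 'n \<Rightarrow> 'e) \<Rightarrow> real ^ 'n \<Rightarrow> 'e set" where
  "normal_sp g F u = {v. \<forall>t\<in>tangent_sp F u. g (F u) v t = 0}"

definition normal_part ::
  "('e::euclidean_space \<Rightarrow> 'e \<Rightarrow> 'e \<Rightarrow> real) \<Rightarrow> (real ^ 'n \<Rightarrow> 'e) \<Rightarrow> real ^ 'n \<Rightarrow> 'e \<Rightarrow> 'e" where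
  "normal_part g F u v = (THE w. w \<in> normal_sp g F u \<and> v - w \<in> tangent_sp F u)"

text \<open>The normal connection \<open>D\<^sub>X \<nu>\<close>.\<close>
definition normal_conn ::
  "('e::euclidean_space \<Rightarrow> 'e \<Rightarrow> 'e \<Rightarrow> real) \<Rightarrow> (real ^ 'n \<Rightarrow> 'e) \<Rightarrow>
   (real ^ 'n \<Rightarrow> real ^ 'n) \<Rightarrow> (real ^ 'n \<Rightarrow> 'e) \<Rightarrow> real ^ 'n \<Rightarrow> 'e" where
  "normal_conn g F X \<nu> u = normal_part g F u (cov_deriv g F (X u) \<nu> u)"

definition lie_bracket ::
  "(real ^ 'n \<Rightarrow> real ^ 'n) \<Rightarrow> (real ^ 'n \<Rightarrow> real ^ 'n) \<Rightarrow> real ^ 'n \<Rightarrow> real ^ 'n" where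
  "lie_bracket X Y u = frechet_derivative Y (at u) (X u) - frechet_derivative X (at u) (Y u)"

text \<open>\<open>R\<^sup>\<bottom>(X, Y) \<nu>\<close>\<close>
definition normal_curvature ::
  "('e::euclidean_space \<Rightarrow> 'e \<Rightarrow> 'e \<Rightarrow> real) \<Rightarrow> (real ^ 'n \<Rightarrow> 'e) \<Rightarrow>
   (real ^ 'n \<Rightarrow> real ^ 'n) \<Rightarrow> (real ^ 'n \<Rightarrow> real ^ 'n) \<Rightarrow> (real ^ 'n \<Rightarrow> 'e) \<Rightarrow> real ^ 'n \<Rightarrow> 'e" where
  "normal_curvature g F X Y \<nu> u =
     normal_conn g F X (normal_conn g F Y \<nu>) u - normal_conn g F Y (normal_conn g F X \<nu>) u
     - normal_conn g F (lie_bracket X Y) \<nu> u"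

text \<open>The second fundamental form, with the second argument extended to a constant coordinate field.\<close>
definition second_fund ::
  "('e::euclidean_space \<Rightarrow> 'e \<Rightarrow> 'e \<Rightarrow> real) \<Rightarrow> (real ^ 'n \<Rightarrow> 'e) \<Rightarrow> real ^ 'n \<Rightarrow> real ^ 'n \<Rightarrow> real ^ 'n \<Rightarrow> 'e" where
  "second_fund g F u a b =
     normal_part g F u (cov_deriv g F a (\<lambda>y. frechet_derivative F (at y) b) u)"

definition first_fund ::
  "('e::euclidean_space \<Rightarrow> 'e \<Rightarrow> 'e \<Rightarrow> real) \<Rightarrow> (real ^ 'n \<Rightarrow> 'e) \<Rightarrow> real ^ 'n \<Rightarrow> real ^ 'n \<Rightarrow> real ^ 'n \<Rightarrow> real" where
  "first_fund g F u a b = g (F u) (frechet_derivative F (at u) a) (frechet_derivative F (at u) b)"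

text \<open>The trace is taken with the inverse of the Gram matrix of the coordinate frame.\<close>
definition mean_curvature ::
  "('e::euclidean_space \<Rightarrow> 'e \<Rightarrow> 'e \<Rightarrow> real) \<Rightarrow> (real ^ 'n \<Rightarrow> 'e) \<Rightarrow> real ^ 'n \<Rightarrow> 'e" where
  "mean_curvature g F u =
     (let G = (\<chi> i j. first_fund g F u (axis i 1) (axis j 1)) :: real ^ 'n ^ 'n
      in (1 / real CARD('n)) *\<^sub>R
           (\<Sum>i\<in>UNIV. \<Sum>j\<in>UNIV. matrix_inv G $ i $ j *\<^sub>R second_fund g F u (axis i 1) (axis j 1)))"

text \<open>The shape operator \<open>A\<^sub>\<eta>\<close>, acting on coordinate vectors of the source.\<close>
definition shape_op ::
  "('e::euclidean_space \<Rightarrow> 'e \<Rightarrow> 'e \<Rightarrow> real) \<Rightarrow> (real ^ 'n \<Rightarrow> 'e) \<Rightarrow> real ^ 'n \<Rightarrow> 'e \<Rightarrow> real ^ 'n \<Rightarrow> real ^ 'n" where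
  "shape_op g F u \<eta> a = (THE c. \<forall>b. first_fund g F u c b = g (F u) (second_fund g F u a b) \<eta>)"

definition umbilical_normal ::
  "('e::euclidean_space \<Rightarrow> 'e \<Rightarrow> 'e \<Rightarrow> real) \<Rightarrow> (real ^ 'n \<Rightarrow> 'e) \<Rightarrow> real ^ 'n \<Rightarrow> 'e \<Rightarrow> bool" where
  "umbilical_normal g F u \<eta> \<longleftrightarrow>
     \<eta> \<in> normal_sp g F u \<and>
     (\<forall>a. shape_op g F u \<eta> a = g (F u) \<eta> (mean_curvature g F u) *\<^sub>R a)"

section \<open>CR submanifolds of maximal CR dimension\<close>

definition holomorphic_tangent_sp :: "(real ^ 'n \<Rightarrow> complex ^ 'm) \<Rightarrow> real ^ 'n \<Rightarrow> (complex ^ 'm) set" where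
  "holomorphic_tangent_sp F u = cplx_struct ` tangent_sp F u \<inter> tangent_sp F u"

text \<open>Here \<open>dim\<close> is the dimension over the reals.\<close>
definition max_CR_dim ::
  "('a, real ^ 'n) chart set \<Rightarrow> ('a \<Rightarrow> (complex ^ ('m::finite) option) set) \<Rightarrow> bool" where
  "max_CR_dim \<A> f \<longleftrightarrow>
     (\<forall>c\<in>\<A>. \<forall>d\<in>affine_atlas. \<forall>u\<in>coord_dom c d f.
        dim (holomorphic_tangent_sp (coord_rep c d f) u) = CARD('n) - 1)"

definition distinguished_normal :: "(real ^ 'n \<Rightarrow> complex ^ 'm) \<Rightarrow> real ^ 'n \<Rightarrow> complex ^ 'm \<Rightarrow> bool" where
  "distinguished_normal F u \<xi> \<longleftrightarrow>
     \<xi> \<in> normal_sp fubini_study F u \<and> fubini_study (F u) \<xi> \<xi> = 1 \<and>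
     cplx_struct ` tangent_sp F u \<subseteq> {t + s |t s. t \<in> tangent_sp F u \<and> s \<in> span {\<xi>}}"

definition flat_normal_connection ::
  "('a, real ^ 'n) chart set \<Rightarrow> ('a \<Rightarrow> (complex ^ ('m::finite) option) set) \<Rightarrow> bool" where
  "flat_normal_connection \<A> f \<longleftrightarrow>
     (\<forall>c\<in>\<A>. \<forall>d\<in>affine_atlas. \<forall>W X Y \<nu>.
        open W \<and> W \<subseteq> coord_dom c d f \<and> smooth_on W X \<and> smooth_on W Y \<and> smooth_on W \<nu> \<and>
        (\<forall>u\<in>W. \<nu> u \<in> normal_sp fubini_study (coord_rep c d f) u) \<longrightarrow>
        (\<forall>u\<in>W. normal_curvature fubini_study (coord_rep c d f) X Y \<nu> u = 0))"

end

theory Submission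
  imports Defs
begin

text \<open>Let \<open>\<eta>\<close> be umbilical at \<open>x\<close>.  Then \<open>A\<^sub>\<eta>\<close> commutes with every shape operator at \<open>x\<close>, so by the Ricci equation
  the flatness of \<open>D\<close> gives \<open>\<langle>R(X, Y)\<nu>, \<eta>\<rangle> = 0\<close> for tangent \<open>X\<close>, \<open>Y\<close> and normal \<open>\<nu>\<close>, where \<open>R\<close> is the curvature
  of the Fubini--Study metric.  As \<open>n > 1\<close>, there is a nonzero \<open>X\<close> with \<open>X\<close> and \<open>JX\<close> both tangent, and
  \<open>Y = JX\<close> turns this into \<open>\<langle>J\<nu>, \<eta>\<rangle> = 0\<close>.  The component \<open>\<eta>'\<close> of \<open>\<eta>\<close> orthogonal to \<open>\<xi>\<close> has a normal
  image \<open>J\<eta>'\<close>, so \<open>\<nu> = J\<eta>'\<close> yields \<open>\<eta>' = 0\<close>.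

  The Ricci equation is obtained in an affine chart, where the Christoffel symbols are
  \<open>\<Gamma>(u, v) = - (\<langle>u, w\<rangle> v + \<langle>v, w\<rangle> u) / (1 + \<bar>w\<bar>\<^sup>2)\<close> with the Hermitian product \<open>\<langle>\<cdot>, \<cdot>\<rangle>\<close>.\<close>

section \<open>Calculus of smooth maps\<close>

text \<open>\<open>frechet_derivative\<close> is a choice among all derivatives at the point, so it
  is enough that both functions have the same derivatives there, possibly none.\<close>

lemma frechet_derivative_cong_open:
  assumes "open S" "x \<in> S" "\<And>y. y \<in> S \<Longrightarrow> f y = g y"
  shows "frechet_derivative f (at x) = frechet_derivative g (at x)"
proof -
  have "(f has_derivative D) (at x) \<longleftrightarrow> (g has_derivative D) (at x)" for D
    using has_derivative_transform_within_open[of f D x UNIV S g]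
      has_derivative_transform_within_open[of g D x UNIV S f] assms by auto
  then show ?thesis
    unfolding frechet_derivative_def by presburger
qed

section \<open>Closure properties of differentiability of finite order\<close>

lemma k_times_diff_on_cong:
  assumes "open S" "\<And>x. x \<in> S \<Longrightarrow> f x = g x" "k_times_diff_on k S f"
  shows "k_times_diff_on k S g"
  using assms(2,3)
proof (induction k arbitrary: f g)
  case 0
  then show ?case by (metis continuous_on_cong k_times_diff_on.simps(1))
next
  case (Suc k)
  have "g differentiable (at x)" if "x \<in> S" for x
  proof -
    have "(f has_derivative frechet_derivative f (at x)) (at x)"
      using Suc.prems(2) that by (simp add: frechet_derivative_works[symmetric])
    from has_derivative_transform_within_open[OF this assms(1) that Suc.prems(1)]
    show ?thesis unfolding differentiable_def by blast
  qed
  moreover have "k_times_diff_on k S (\<lambda>x. frechet_derivative g (at x) v)" for v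
  proof (rule Suc.IH[of "\<lambda>x. frechet_derivative f (at x) v"])
    show "frechet_derivative f (at x) v = frechet_derivative g (at x) v" if "x \<in> S" for x
      by (simp only: frechet_derivative_cong_open[OF assms(1) that Suc.prems(1)])
    show "k_times_diff_on k S (\<lambda>x. frechet_derivative f (at x) v)"
      using Suc.prems(2) by simp
  qed
  ultimately show ?case by simp
qed

text \<open>Admits a derivative found by the differentiation rules in place of
  \<open>frechet_derivative\<close>; the closure properties below rest on it.\<close>

lemma k_times_diff_on_SucI:
  assumes "open S" "\<And>x. x \<in> S \<Longrightarrow> (f has_derivative f' x) (at x)"
    and "\<And>v. k_times_diff_on k S (\<lambda>x. f' x v)"
  shows "k_times_diff_on (Suc k) S f"
proof -
  have "k_times_diff_on k S (\<lambda>x. frechet_derivative f (at x) v)" for v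
    by (rule k_times_diff_on_cong[OF assms(1) _ assms(3)])
      (simp only: frechet_derivative_at[OF assms(2), symmetric])
  then show ?thesis
    using assms(2) by (auto simp: differentiable_def)
qed

lemma k_times_diff_on_SucD: "k_times_diff_on (Suc k) S f \<Longrightarrow> k_times_diff_on k S f"
proof (induction k arbitrary: f)
  case 0
  then show ?case
    by (auto intro!: differentiable_imp_continuous_on
        simp: differentiable_on_def differentiable_at_withinI)
next
  case (Suc k)
  then show ?case
    by (metis k_times_diff_on.simps(2))
qed

lemma k_times_diff_on_const: "open S \<Longrightarrow> k_times_diff_on k S (\<lambda>_. c)"
proof (induction k arbitrary: c)
  case (Suc k)
  then show ?case by (intro k_times_diff_on_SucI[where f' = "\<lambda>_ _. 0"]) auto
qed simp

lemma k_times_diff_on_has_derivative: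
  "k_times_diff_on (Suc k) S f \<Longrightarrow> x \<in> S \<Longrightarrow> (f has_derivative frechet_derivative f (at x)) (at x)"
  by (simp add: frechet_derivative_works[symmetric])

lemma k_times_diff_on_add:
  assumes "open S"
  shows "k_times_diff_on k S f \<Longrightarrow> k_times_diff_on k S g \<Longrightarrow> k_times_diff_on k S (\<lambda>x. f x + g x)"
proof (induction k arbitrary: f g)
  case (Suc k)
  show ?case
    by (rule k_times_diff_on_SucI[OF assms
          has_derivative_add[OF k_times_diff_on_has_derivative[OF Suc.prems(1)]
            k_times_diff_on_has_derivative[OF Suc.prems(2)]]])
      (use Suc in auto)
qed (auto intro: continuous_intros)

text \<open>By the product rule the derivative is a sum of two values of \<open>B\<close> at pairs
  of functions of order \<open>k\<close>, which is why the induction generalises \<open>f\<close>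
  and \<open>g\<close>. Numerical products, scalings and the Hermitian product are later
  instances.\<close>

lemma k_times_diff_on_bounded_bilinear:
  assumes "bounded_bilinear B" "open S"
  shows "k_times_diff_on k S f \<Longrightarrow> k_times_diff_on k S g \<Longrightarrow> k_times_diff_on k S (\<lambda>x. B (f x) (g x))"
proof (induction k arbitrary: f g)
  case 0
  then show ?case by (simp add: bounded_bilinear.continuous_on[OF assms(1)])
next
  case (Suc k)
  have "k_times_diff_on k S (\<lambda>x. frechet_derivative f (at x) v)"
    "k_times_diff_on k S (\<lambda>x. frechet_derivative g (at x) v)" for v
    using Suc.prems by auto
  then have D: "k_times_diff_on k S
      (\<lambda>x. B (f x) (frechet_derivative g (at x) v) + B (frechet_derivative f (at x) v) (g x))" for v
    by (intro k_times_diff_on_add assms(2) Suc.IH k_times_diff_on_SucD[OF Suc.prems(1)]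
        k_times_diff_on_SucD[OF Suc.prems(2)])
  show ?case
    by (rule k_times_diff_on_SucI[OF assms(2)
          bounded_bilinear.FDERIV[OF assms(1) k_times_diff_on_has_derivative[OF Suc.prems(1)]
            k_times_diff_on_has_derivative[OF Suc.prems(2)]] D])
qed

text \<open>The derivative of \<open>1 / f\<close> is \<open>- (1 / f) * f' * (1 / f)\<close>, in
  which \<open>1 / f\<close> itself recurs, so its smoothness of order \<open>k\<close> yields that
  of order \<open>Suc k\<close>.\<close>

lemma k_times_diff_on_inverse:
  fixes f :: "'a::real_normed_vector \<Rightarrow> real"
  assumes "open S" "\<And>x. x \<in> S \<Longrightarrow> f x \<noteq> 0"
  shows "k_times_diff_on k S f \<Longrightarrow> k_times_diff_on k S (\<lambda>x. inverse (f x))"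
proof (induction k)
  case 0
  then show ?case using assms by (auto intro: continuous_intros)
next
  case (Suc k)
  have f: "k_times_diff_on k S f" and i: "k_times_diff_on k S (\<lambda>x. inverse (f x))"
    using Suc k_times_diff_on_SucD by auto
  have f': "k_times_diff_on k S (\<lambda>x. frechet_derivative f (at x) v)" for v
    using Suc.prems by simp
  note mult = k_times_diff_on_bounded_bilinear[OF bounded_bilinear_mult \<open>open S\<close>]
  have "k_times_diff_on k S (\<lambda>x. (- 1) * ((inverse (f x) * frechet_derivative f (at x) v) * inverse (f x)))" for v
    by (intro mult i f' k_times_diff_on_const assms)
  then have D: "k_times_diff_on k S (\<lambda>x. - (inverse (f x) * frechet_derivative f (at x) v * inverse (f x)))" for v
    by simp
  show ?case
    by (rule k_times_diff_on_SucI[OF assms(1)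
          Deriv.has_derivative_inverse[OF assms(2) k_times_diff_on_has_derivative[OF Suc.prems]] D])
qed

section \<open>Closure properties of smooth maps\<close>

lemma smooth_on_const: "open S \<Longrightarrow> smooth_on S (\<lambda>_. c)"
  by (simp add: smooth_on_def k_times_diff_on_const)

lemma smooth_on_bounded_bilinear:
  "bounded_bilinear B \<Longrightarrow> open S \<Longrightarrow> smooth_on S f \<Longrightarrow> smooth_on S g \<Longrightarrow> smooth_on S (\<lambda>x. B (f x) (g x))"
  by (simp add: smooth_on_def k_times_diff_on_bounded_bilinear)

lemma smooth_on_bounded_linear:
  assumes "bounded_linear L" "open S" "smooth_on S f"
  shows "smooth_on S (\<lambda>x. L (f x))"
  \<comment> \<open>The linear map is read as the bilinear map
    \<open>\<lambda>r y. r *\<^sub>R L y\<close> with \<open>r\<close> the constant 1.\<close>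
  using smooth_on_bounded_bilinear[OF bounded_bilinear.comp[OF bounded_bilinear_scaleR bounded_linear_ident assms(1)]
      assms(2) smooth_on_const[OF assms(2), of 1] assms(3)]
  by simp

lemma smooth_on_add:
  "open S \<Longrightarrow> smooth_on S f \<Longrightarrow> smooth_on S g \<Longrightarrow> smooth_on S (\<lambda>x. f x + g x)"
  by (simp add: smooth_on_def k_times_diff_on_add)

lemma smooth_on_uminus: "open S \<Longrightarrow> smooth_on S f \<Longrightarrow> smooth_on S (\<lambda>x. - f x)"
  by (rule smooth_on_bounded_linear[OF bounded_linear_minus[OF bounded_linear_ident]])

lemma smooth_on_diff:
  assumes "open S" "smooth_on S f" "smooth_on S g"
  shows "smooth_on S (\<lambda>x. f x - g x)"
  using smooth_on_add[OF assms(1,2) smooth_on_uminus[OF assms(1,3)]] by simp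

lemma smooth_on_sum:
  assumes "open S" "\<And>i. i \<in> I \<Longrightarrow> smooth_on S (f i)"
  shows "smooth_on S (\<lambda>x. \<Sum>i\<in>I. f i x)"
  using assms(2)
  by (induction I rule: infinite_finite_induct) (auto simp: smooth_on_const smooth_on_add assms(1))

lemma smooth_on_inverse:
  fixes f :: "'a::real_normed_vector \<Rightarrow> real"
  shows "open S \<Longrightarrow> (\<And>x. x \<in> S \<Longrightarrow> f x \<noteq> 0) \<Longrightarrow> smooth_on S f \<Longrightarrow> smooth_on S (\<lambda>x. inverse (f x))"
  by (simp add: smooth_on_def k_times_diff_on_inverse)

lemmas smooth_on_mult = smooth_on_bounded_bilinear[OF bounded_bilinear_mult]
lemmas smooth_on_scaleR = smooth_on_bounded_bilinear[OF bounded_bilinear_scaleR]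

lemma smooth_on_divide:
  fixes f :: "'a::real_normed_vector \<Rightarrow> real"
  shows "open S \<Longrightarrow> (\<And>x. x \<in> S \<Longrightarrow> g x \<noteq> 0) \<Longrightarrow> smooth_on S f \<Longrightarrow> smooth_on S g \<Longrightarrow>
    smooth_on S (\<lambda>x. f x / g x)"
  by (simp add: divide_inverse smooth_on_mult smooth_on_inverse)

lemma smooth_on_has_derivative:
  "smooth_on S f \<Longrightarrow> x \<in> S \<Longrightarrow> (f has_derivative frechet_derivative f (at x)) (at x)"
  unfolding smooth_on_def by (rule k_times_diff_on_has_derivative[of 0]) (erule spec, assumption)

lemma smooth_on_frechet_derivative:
  "smooth_on S f \<Longrightarrow> smooth_on S (\<lambda>x. frechet_derivative f (at x) v)"
  unfolding smooth_on_def
proof (rule allI)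
  fix k assume "\<forall>k. k_times_diff_on k S f"
  then have "k_times_diff_on (Suc k) S f" by (rule spec)
  then show "k_times_diff_on k S (\<lambda>x. frechet_derivative f (at x) v)" by simp
qed

lemma smooth_on_imp_continuous_on: "smooth_on S f \<Longrightarrow> continuous_on S f"
  unfolding smooth_on_def using k_times_diff_on.simps(1) by blast

section \<open>Symmetry of second derivatives\<close>

text \<open>The second difference of \<open>f\<close> is a mixed derivative at an intermediate point, and it is symmetric
  in the two directions.\<close>
lemma second_difference_mean_value:
  fixes f :: "'a::real_normed_vector \<Rightarrow> real"
  assumes f: "smooth_on S f" and h: "h > 0"
    and S: "\<And>s t. 0 \<le> s \<Longrightarrow> s \<le> h \<Longrightarrow> 0 \<le> t \<Longrightarrow> t \<le> h \<Longrightarrow> x + s *\<^sub>R a + t *\<^sub>R b \<in> S"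
  obtains s t where "0 < s" "s < h" "0 < t" "t < h"
    "f (x + h *\<^sub>R a + h *\<^sub>R b) - f (x + h *\<^sub>R a) - f (x + h *\<^sub>R b) + f x =
      h\<^sup>2 * frechet_derivative (\<lambda>y. frechet_derivative f (at y) a) (at (x + s *\<^sub>R a + t *\<^sub>R b)) b"
proof -
  let ?fa = "\<lambda>y. frechet_derivative f (at y) a"
  have along: "((\<lambda>s. f (x + s *\<^sub>R a + t *\<^sub>R b)) has_real_derivative ?fa (x + s *\<^sub>R a + t *\<^sub>R b)) (at s)"
    if "0 \<le> s" "s \<le> h" "0 \<le> t" "t \<le> h" for s t
  proof -
    have "((\<lambda>s. x + s *\<^sub>R a + t *\<^sub>R b) has_derivative (\<lambda>r. r *\<^sub>R a)) (at s)"
      by (auto intro!: derivative_eq_intros)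
    from has_derivative_compose[OF this smooth_on_has_derivative[OF f S[OF that]]]
    show ?thesis
      unfolding has_field_derivative_def
      by (rule has_derivative_eq_rhs)
        (simp add: fun_eq_iff linear_cmul[OF has_derivative_linear[OF smooth_on_has_derivative[OF f S[OF that]]]] mult.commute)
  qed
  \<comment> \<open>Mean value theorem in \<open>s\<close> for the increment of \<open>f\<close>
    along \<open>h *\<^sub>R b\<close>. The terms with factor 0 keep the shape of
    \<open>along\<close>.\<close>
  have "\<exists>s>0. s < h \<and> (f (x + h *\<^sub>R a + h *\<^sub>R b) - f (x + h *\<^sub>R a + 0 *\<^sub>R b)) -
      (f (x + 0 *\<^sub>R a + h *\<^sub>R b) - f (x + 0 *\<^sub>R a + 0 *\<^sub>R b)) =
      (h - 0) * (?fa (x + s *\<^sub>R a + h *\<^sub>R b) - ?fa (x + s *\<^sub>R a + 0 *\<^sub>R b))"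
    by (rule MVT2[OF h]) (use h in \<open>auto intro!: DERIV_diff along simp del: scaleR_zero_left\<close>)
  then obtain s where s: "0 < s" "s < h"
    "(f (x + h *\<^sub>R a + h *\<^sub>R b) - f (x + h *\<^sub>R a)) - (f (x + h *\<^sub>R b) - f x) =
      h * (?fa (x + s *\<^sub>R a + h *\<^sub>R b) - ?fa (x + s *\<^sub>R a + 0 *\<^sub>R b))"
    by auto
  let ?fab = "\<lambda>y. frechet_derivative ?fa (at y) b"
  have fa: "smooth_on S ?fa" by (rule smooth_on_frechet_derivative[OF f])
  have along2: "((\<lambda>t. ?fa (x + s *\<^sub>R a + t *\<^sub>R b)) has_real_derivative ?fab (x + s *\<^sub>R a + t *\<^sub>R b)) (at t)"
    if "0 \<le> t" "t \<le> h" for t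
  proof -
    have mem: "x + s *\<^sub>R a + t *\<^sub>R b \<in> S" using S s that by simp
    have "((\<lambda>t. x + s *\<^sub>R a + t *\<^sub>R b) has_derivative (\<lambda>r. r *\<^sub>R b)) (at t)"
      by (auto intro!: derivative_eq_intros)
    from has_derivative_compose[OF this smooth_on_has_derivative[OF fa mem]]
    show ?thesis
      unfolding has_field_derivative_def
      by (rule has_derivative_eq_rhs)
        (simp add: fun_eq_iff linear_cmul[OF has_derivative_linear[OF smooth_on_has_derivative[OF fa mem]]] mult.commute)
  qed
  \<comment> \<open>A second application, now to \<open>?fa\<close> as a function of
    \<open>t\<close>.\<close>
  have "\<exists>t>0. t < h \<and> ?fa (x + s *\<^sub>R a + h *\<^sub>R b) - ?fa (x + s *\<^sub>R a + 0 *\<^sub>R b) =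
      (h - 0) * ?fab (x + s *\<^sub>R a + t *\<^sub>R b)"
    by (rule MVT2[OF h]) (auto intro: along2)
  then obtain t where t: "0 < t" "t < h"
    "?fa (x + s *\<^sub>R a + h *\<^sub>R b) - ?fa (x + s *\<^sub>R a + 0 *\<^sub>R b) = h * ?fab (x + s *\<^sub>R a + t *\<^sub>R b)"
    by auto
  have "f (x + h *\<^sub>R a + h *\<^sub>R b) - f (x + h *\<^sub>R a) - f (x + h *\<^sub>R b) + f x =
      h * (h * ?fab (x + s *\<^sub>R a + t *\<^sub>R b))"
    unfolding t(3)[symmetric] s(3)[symmetric] by simp
  then show thesis
    by (intro that[OF s(1,2) t(1,2)]) (simp add: power2_eq_square mult.assoc)
qed

text \<open>One and the same second difference, divided by \<open>h\<^sup>2\<close>, is a value of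
  either mixed derivative at a point near \<open>x\<close>. Both are continuous, so their values at
  \<open>x\<close> differ by at most any given \<open>e\<close>.\<close>

lemma frechet_derivative_commute_real:
  fixes f :: "'a::real_normed_vector \<Rightarrow> real"
  assumes S: "open S" and f: "smooth_on S f" and x: "x \<in> S"
  shows "frechet_derivative (\<lambda>y. frechet_derivative f (at y) a) (at x) b =
    frechet_derivative (\<lambda>y. frechet_derivative f (at y) b) (at x) a" (is "?D a b x = ?D b a x")
proof -
  have close: "\<exists>r>0. \<forall>y. norm (y - x) < r \<longrightarrow> y \<in> S \<and> \<bar>?D a b y - ?D a b x\<bar> < e" if "e > 0" for e a b
  proof -
    have "smooth_on S (?D a b)"
      by (intro smooth_on_frechet_derivative f)
    then have "isCont (?D a b) x"
      using S x continuous_on_eq_continuous_at smooth_on_imp_continuous_on by blast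
    then have "\<exists>r>0. \<forall>y. dist y x < r \<longrightarrow> dist (?D a b y) (?D a b x) < e"
      using that unfolding continuous_at_eps_delta by blast
    then obtain r where r: "r > 0" "\<forall>y. dist y x < r \<longrightarrow> dist (?D a b y) (?D a b x) < e"
      by blast
    obtain q where q: "q > 0" "ball x q \<subseteq> S"
      using S x openE by blast
    have "\<forall>y. norm (y - x) < min r q \<longrightarrow> y \<in> S \<and> \<bar>?D a b y - ?D a b x\<bar> < e"
    proof (intro allI impI conjI)
      fix y assume y: "norm (y - x) < min r q"
      then show "y \<in> S" using q(2) by (auto simp: dist_norm norm_minus_commute)
      show "\<bar>?D a b y - ?D a b x\<bar> < e" using r(2) y by (simp add: dist_norm)
    qed
    then show ?thesis using r(1) q(1) by (metis min_less_iff_conj)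
  qed
  have "\<bar>?D a b x - ?D b a x\<bar> \<le> e" if e: "e > 0" for e
  proof -
    obtain r where r: "r > 0" "\<And>y. norm (y - x) < r \<Longrightarrow> y \<in> S \<and> \<bar>?D a b y - ?D a b x\<bar> < e / 2"
      using close[OF half_gt_zero[OF e], of a b] by blast
    obtain q where q: "q > 0" "\<And>y. norm (y - x) < q \<Longrightarrow> \<bar>?D b a y - ?D b a x\<bar> < e / 2"
      using close[OF half_gt_zero[OF e], of b a] by blast
    \<comment> \<open>\<open>N\<close> exceeds the sum of the two norms, and the summand 1 keeps it
      positive; so the \<open>h\<close> below puts the parallelogram spanned at \<open>x\<close> by
      \<open>h *\<^sub>R a\<close> and \<open>h *\<^sub>R b\<close> into both
      neighbourhoods.\<close>
    define N where "N = norm a + norm b + 1"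
    have N: "N > 0" "norm a + norm b < N" unfolding N_def by (auto intro: add_nonneg_pos)
    define h where "h = min r q / N"
    have h: "h > 0" "h * N = min r q" using r(1) q(1) N by (auto simp: h_def)
    have small: "norm (s *\<^sub>R a + t *\<^sub>R b) < min r q" if "0 \<le> s" "s \<le> h" "0 \<le> t" "t \<le> h" for s t
    proof -
      have "norm (s *\<^sub>R a + t *\<^sub>R b) \<le> s * norm a + t * norm b"
        using norm_triangle_ineq[of "s *\<^sub>R a" "t *\<^sub>R b"] that by simp
      also have "\<dots> \<le> h * (norm a + norm b)"
        using that by (simp add: distrib_left add_mono mult_right_mono)
      also have "\<dots> < h * N" using h(1) N(2) by simp
      finally show ?thesis using h(2) by simp
    qed
    have S1: "x + s *\<^sub>R a + t *\<^sub>R b \<in> S" if "0 \<le> s" "s \<le> h" "0 \<le> t" "t \<le> h" for s t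
      using r(2)[of "x + s *\<^sub>R a + t *\<^sub>R b"] small[OF that] by (simp add: add.assoc)
    have S2: "x + s *\<^sub>R b + t *\<^sub>R a \<in> S" if "0 \<le> s" "s \<le> h" "0 \<le> t" "t \<le> h" for s t
      using S1[OF that(3,4,1,2)] by (simp add: algebra_simps)
    obtain s t where st: "0 < s" "s < h" "0 < t" "t < h"
      "f (x + h *\<^sub>R a + h *\<^sub>R b) - f (x + h *\<^sub>R a) - f (x + h *\<^sub>R b) + f x = h\<^sup>2 * ?D a b (x + s *\<^sub>R a + t *\<^sub>R b)"
      by (rule second_difference_mean_value[OF f h(1) S1])
    obtain s' t' where st': "0 < s'" "s' < h" "0 < t'" "t' < h"
      "f (x + h *\<^sub>R b + h *\<^sub>R a) - f (x + h *\<^sub>R b) - f (x + h *\<^sub>R a) + f x = h\<^sup>2 * ?D b a (x + s' *\<^sub>R b + t' *\<^sub>R a)"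
      by (rule second_difference_mean_value[OF f h(1) S2])
    have "h\<^sup>2 * ?D a b (x + s *\<^sub>R a + t *\<^sub>R b) = h\<^sup>2 * ?D b a (x + s' *\<^sub>R b + t' *\<^sub>R a)"
      unfolding st(5)[symmetric] st'(5)[symmetric] by (simp add: add.assoc add.commute[of "h *\<^sub>R a"])
    then have "?D a b (x + s *\<^sub>R a + t *\<^sub>R b) = ?D b a (x + s' *\<^sub>R b + t' *\<^sub>R a)"
      using h(1) by simp
    moreover have "\<bar>?D a b (x + s *\<^sub>R a + t *\<^sub>R b) - ?D a b x\<bar> < e / 2"
      using r(2)[of "x + s *\<^sub>R a + t *\<^sub>R b"] small[of s t] st by (simp add: add.assoc)
    moreover have "\<bar>?D b a (x + s' *\<^sub>R b + t' *\<^sub>R a) - ?D b a x\<bar> < e / 2"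
      using q(2)[of "x + s' *\<^sub>R b + t' *\<^sub>R a"] small[of t' s'] st' by (simp add: add.assoc add.commute)
    ultimately show ?thesis by linarith
  qed
  then have "\<bar>?D a b x - ?D b a x\<bar> \<le> 0"
    by (rule field_le_epsilon) simp
  then show ?thesis by simp
qed

text \<open>Pairing with every vector \<open>c\<close> reduces this to real-valued maps.\<close>

lemma frechet_derivative_commute:
  fixes f :: "'a::real_normed_vector \<Rightarrow> 'b::real_inner"
  assumes S: "open S" and f: "smooth_on S f" and x: "x \<in> S"
  shows "frechet_derivative (\<lambda>y. frechet_derivative f (at y) a) (at x) b =
    frechet_derivative (\<lambda>y. frechet_derivative f (at y) b) (at x) a" (is "?D a b = ?D b a")
proof -
  have comp: "frechet_derivative (\<lambda>y. g y \<bullet> c) (at y) a = frechet_derivative g (at y) a \<bullet> c"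
    if "smooth_on S g" "y \<in> S" for g :: "'a \<Rightarrow> 'b" and y a c
    by (simp only: frechet_derivative_at[OF has_derivative_inner_left[OF smooth_on_has_derivative[OF that]], symmetric])
  have "?D a b \<bullet> c = ?D b a \<bullet> c" for c
  proof -
    have fc: "smooth_on S (\<lambda>y. f y \<bullet> c)"
      by (rule smooth_on_bounded_linear[OF bounded_linear_inner_left S f])
    have "frechet_derivative (\<lambda>y. frechet_derivative (\<lambda>y. f y \<bullet> c) (at y) a) (at x) b = ?D a b \<bullet> c" for a b
      by (simp only: frechet_derivative_cong_open[OF S x comp[OF f]]
          comp[OF smooth_on_frechet_derivative[OF f] x])
    then show ?thesis
      using frechet_derivative_commute_real[OF S fc x, of a b] by simp
  qed
  then show ?thesis
    by (metis vector_eq_rdot)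
qed

section \<open>The Fubini--Study metric in an affine chart\<close>

lemma bounded_bilinear_hermitian_inner: "bounded_bilinear (hermitian_inner :: complex ^ 'm \<Rightarrow> _)"
  unfolding bilinear_conv_bounded_bilinear[symmetric] bilinear_def
  by (auto simp: linear_iff hermitian_inner_def algebra_simps sum.distrib scaleR_sum_right)

lemma bounded_bilinear_vector_scalar_mult:
  "bounded_bilinear ((*s) :: complex \<Rightarrow> complex ^ 'm \<Rightarrow> _)"
  unfolding bilinear_conv_bounded_bilinear[symmetric] bilinear_def
  by (auto simp: linear_iff vec_eq_iff algebra_simps)

lemmas hermitian_inner_bilinear =
  bounded_bilinear.add_left[OF bounded_bilinear_hermitian_inner]
  bounded_bilinear.add_right[OF bounded_bilinear_hermitian_inner]
  bounded_bilinear.diff_left[OF bounded_bilinear_hermitian_inner]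
  bounded_bilinear.diff_right[OF bounded_bilinear_hermitian_inner]
  bounded_bilinear.minus_left[OF bounded_bilinear_hermitian_inner]
  bounded_bilinear.minus_right[OF bounded_bilinear_hermitian_inner]
  bounded_bilinear.scaleR_left[OF bounded_bilinear_hermitian_inner]
  bounded_bilinear.scaleR_right[OF bounded_bilinear_hermitian_inner]

lemma hermitian_inner_smult_left: "hermitian_inner (a *s u) v = a * hermitian_inner u v"
  by (simp add: hermitian_inner_def sum_distrib_left mult.assoc)

lemma hermitian_inner_smult_right: "hermitian_inner u (a *s v) = cnj a * hermitian_inner u v"
  by (simp add: hermitian_inner_def sum_distrib_left mult_ac)

lemma cnj_hermitian_inner: "cnj (hermitian_inner u v) = hermitian_inner v u"
  by (simp add: hermitian_inner_def mult.commute)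

lemma Re_hermitian_inner: "Re (hermitian_inner u v) = u \<bullet> v"
  by (simp add: hermitian_inner_def inner_vec_def inner_complex_def)

lemma hermitian_inner_self: "hermitian_inner u u = of_real ((norm u)\<^sup>2)"
proof -
  have "Im (hermitian_inner u u) = 0"
    using arg_cong[OF cnj_hermitian_inner[of u u], of Im] by simp
  then show ?thesis
    by (simp add: complex_eq_iff Re_hermitian_inner power2_norm_eq_inner)
qed

lemma norm_smult: "norm (a *s u) = cmod a * norm (u :: complex ^ 'm)"
proof -
  have "of_real ((norm (a *s u))\<^sup>2) = (of_real ((cmod a * norm u)\<^sup>2) :: complex)"
    unfolding hermitian_inner_self[symmetric] hermitian_inner_smult_left hermitian_inner_smult_right
    by (simp add: hermitian_inner_self power_mult_distrib complex_norm_square[symmetric] mult_ac)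
  then show ?thesis
    by (simp add: power2_eq_iff_nonneg del: of_real_power)
qed

text \<open>A unit scalar \<open>c\<close> rotates the product onto its modulus, hence onto a real
  part; the real inequality then applies to \<open>c *s u\<close>.\<close>

lemma hermitian_Cauchy_Schwarz: "cmod (hermitian_inner u v) \<le> norm u * norm v"
proof -
  obtain c where c: "cmod c = 1" "of_real (cmod (hermitian_inner u v)) = c * hermitian_inner u v"
  proof (cases "hermitian_inner u v = 0")
    case False
    then show ?thesis
      by (intro that[of "cnj (hermitian_inner u v) / of_real (cmod (hermitian_inner u v))"])
        (auto simp: norm_divide complex_norm_square[symmetric] power2_eq_square field_simps)
  qed (use that[of 1] in simp)
  have "cmod (hermitian_inner u v) = Re (hermitian_inner (c *s u) v)"
    unfolding hermitian_inner_smult_left c(2)[symmetric] by simp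
  also have "\<dots> \<le> norm (c *s u) * norm v"
    unfolding Re_hermitian_inner by (rule norm_cauchy_schwarz)
  finally show ?thesis by (simp add: norm_smult c(1))
qed

text \<open>The Hermitian form whose real part is the metric. Writing
  \<open>hermitian_inner w w\<close> for the squared norm makes it a rational expression in
  Hermitian products, so identities reduce to arithmetic in the complex field.\<close>

definition fs_hermitian :: "complex ^ 'm \<Rightarrow> complex ^ 'm \<Rightarrow> complex ^ 'm \<Rightarrow> complex" where
  "fs_hermitian w u v =
     ((1 + hermitian_inner w w) * hermitian_inner u v - hermitian_inner u w * hermitian_inner w v)
       / (1 + hermitian_inner w w)\<^sup>2"

lemma one_plus_hermitian_inner_self: "1 + hermitian_inner w w = of_real (1 + (norm w)\<^sup>2)"
  by (simp add: hermitian_inner_self)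

lemma one_plus_norm_power2_pos: "1 + (norm w)\<^sup>2 > (0::real)"
  by (rule add_pos_nonneg) auto

lemma one_plus_hermitian_inner_self_nonzero: "1 + hermitian_inner w w \<noteq> 0"
  unfolding one_plus_hermitian_inner_self of_real_eq_0_iff
  using one_plus_norm_power2_pos[of w] by linarith

lemma fubini_study_eq_Re: "fubini_study w u v = Re (fs_hermitian w u v)"
  unfolding fubini_study_def fs_hermitian_def one_plus_hermitian_inner_self
  by (simp flip: of_real_power of_real_add add: Re_divide_of_real)

lemma cnj_fs_hermitian: "cnj (fs_hermitian w u v) = fs_hermitian w v u"
  by (simp add: fs_hermitian_def cnj_hermitian_inner mult.commute)

lemma fubini_study_commute: "fubini_study w u v = fubini_study w v u"
  unfolding fubini_study_eq_Re by (subst cnj_fs_hermitian[symmetric]) simp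

lemma fs_hermitian_add_left: "fs_hermitian w (u + u') v = fs_hermitian w u v + fs_hermitian w u' v"
  unfolding fs_hermitian_def add_divide_distrib[symmetric]
  by (simp add: hermitian_inner_bilinear algebra_simps)

lemma fs_hermitian_smult_left: "fs_hermitian w (a *s u) v = a * fs_hermitian w u v"
  by (simp add: fs_hermitian_def hermitian_inner_smult_left algebra_simps)

lemma fs_hermitian_add_right: "fs_hermitian w u (v + v') = fs_hermitian w u v + fs_hermitian w u v'"
  by (metis cnj_fs_hermitian complex_cnj_add fs_hermitian_add_left)

lemma fs_hermitian_smult_right: "fs_hermitian w u (a *s v) = cnj a * fs_hermitian w u v"
  by (metis cnj_fs_hermitian complex_cnj_mult fs_hermitian_smult_left)

lemma scaleR_eq_smult: "r *\<^sub>R u = complex_of_real r *s u"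
  by (simp add: vec_eq_iff scaleR_conv_of_real[symmetric])

lemma bounded_bilinear_fubini_study: "bounded_bilinear (fubini_study (w :: complex ^ 'm))"
  unfolding bilinear_conv_bounded_bilinear[symmetric] bilinear_def
  by (auto simp: linear_iff fubini_study_eq_Re fs_hermitian_add_left fs_hermitian_add_right
      fs_hermitian_smult_left fs_hermitian_smult_right scaleR_eq_smult)

lemmas fubini_study_bilinear =
  bounded_bilinear.add_left[OF bounded_bilinear_fubini_study]
  bounded_bilinear.add_right[OF bounded_bilinear_fubini_study]
  bounded_bilinear.diff_left[OF bounded_bilinear_fubini_study]
  bounded_bilinear.diff_right[OF bounded_bilinear_fubini_study]
  bounded_bilinear.minus_left[OF bounded_bilinear_fubini_study]
  bounded_bilinear.minus_right[OF bounded_bilinear_fubini_study]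
  bounded_bilinear.scaleR_left[OF bounded_bilinear_fubini_study]
  bounded_bilinear.scaleR_right[OF bounded_bilinear_fubini_study]
  bounded_bilinear.sum_left[OF bounded_bilinear_fubini_study]
  bounded_bilinear.sum_right[OF bounded_bilinear_fubini_study]
  bounded_bilinear.zero_left[OF bounded_bilinear_fubini_study]
  bounded_bilinear.zero_right[OF bounded_bilinear_fubini_study]

text \<open>Cauchy--Schwarz bounds the subtracted term by the product of the squared norms of
  \<open>u\<close> and \<open>w\<close>; the summand 1 in \<open>1 + (norm w)\<^sup>2\<close> leaves
  the squared norm of \<open>u\<close> over.\<close>

lemma fubini_study_pos:
  assumes "u \<noteq> 0"
  shows "fubini_study w u u > 0"
proof -
  have "Re (hermitian_inner u w * hermitian_inner w u) = (cmod (hermitian_inner u w))\<^sup>2"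
    unfolding cnj_hermitian_inner[of u w, symmetric] complex_norm_square[symmetric] by simp
  also have "\<dots> \<le> (norm u)\<^sup>2 * (norm w)\<^sup>2"
    using power_mono[OF hermitian_Cauchy_Schwarz[of u w], of 2] by (simp add: power_mult_distrib)
  also have "\<dots> < (1 + (norm w)\<^sup>2) * (norm u)\<^sup>2"
    using assms by (simp add: algebra_simps)
  finally show ?thesis
    unfolding fubini_study_def hermitian_inner_self
    by (intro divide_pos_pos) (use one_plus_norm_power2_pos[of w] in \<open>simp_all add: power2_eq_square\<close>)
qed

lemma fubini_study_eq_0_iff: "fubini_study w u u = 0 \<longleftrightarrow> u = 0"
  using fubini_study_pos[of u w] by (force simp: fubini_study_bilinear)

lemma cplx_struct_cplx_struct: "cplx_struct (cplx_struct v) = - v"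
  by (simp add: cplx_struct_def vec_eq_iff)

lemma fubini_study_J_left: "fubini_study w (cplx_struct u) v = - fubini_study w u (cplx_struct v)"
  by (simp add: fubini_study_eq_Re cplx_struct_def fs_hermitian_smult_left fs_hermitian_smult_right)

section \<open>Levi-Civita connection and curvature of the Fubini--Study metric\<close>

definition fs_coeff :: "complex ^ 'm \<Rightarrow> complex ^ 'm \<Rightarrow> complex" where
  "fs_coeff w u = hermitian_inner u w / (1 + hermitian_inner w w)"

definition fs_christoffel :: "complex ^ 'm \<Rightarrow> complex ^ 'm \<Rightarrow> complex ^ 'm \<Rightarrow> complex ^ 'm" where
  "fs_christoffel w u v = - (fs_coeff w u *s v + fs_coeff w v *s u)"

lemma fs_christoffel_commute: "fs_christoffel w u v = fs_christoffel w v u"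
  by (simp add: fs_christoffel_def add.commute)

lemma bounded_bilinear_fs_christoffel: "bounded_bilinear (fs_christoffel (w :: complex ^ 'm))"
  unfolding bilinear_conv_bounded_bilinear[symmetric] bilinear_def
  by (auto simp: linear_iff fs_christoffel_def fs_coeff_def vec_eq_iff hermitian_inner_bilinear
      add_divide_distrib algebra_simps scaleR_conv_of_real[where 'a = complex])

lemmas has_derivative_hermitian_inner = bounded_bilinear.FDERIV[OF bounded_bilinear_hermitian_inner]

text \<open>Compatibility of the connection \<open>fs_christoffel\<close> with the Hermitian form,
  for fields \<open>A\<close> and \<open>B\<close> along a map \<open>F\<close>: the terms of the
  quotient rule regroup into the two Christoffel corrections.\<close>

lemma has_derivative_fs_hermitian:
  assumes F: "(F has_derivative F') (at x)"
    and A: "(A has_derivative A') (at x)" and B: "(B has_derivative B') (at x)"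
  shows "((\<lambda>y. fs_hermitian (F y) (A y) (B y)) has_derivative
    (\<lambda>h. fs_hermitian (F x) (A' h + fs_christoffel (F x) (F' h) (A x)) (B x)
       + fs_hermitian (F x) (A x) (B' h + fs_christoffel (F x) (F' h) (B x)))) (at x)"
proof -
  note P = one_plus_hermitian_inner_self_nonzero
  have "((\<lambda>y. (1 + hermitian_inner (F y) (F y)) * hermitian_inner (A y) (B y)
      - hermitian_inner (A y) (F y) * hermitian_inner (F y) (B y)) has_derivative
     (\<lambda>h. (1 + hermitian_inner (F x) (F x)) * (hermitian_inner (A x) (B' h) + hermitian_inner (A' h) (B x))
        + (0 + (hermitian_inner (F x) (F' h) + hermitian_inner (F' h) (F x))) * hermitian_inner (A x) (B x)
        - (hermitian_inner (A x) (F x) * (hermitian_inner (F x) (B' h) + hermitian_inner (F' h) (B x))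
           + (hermitian_inner (A x) (F' h) + hermitian_inner (A' h) (F x)) * hermitian_inner (F x) (B x)))) (at x)"
    (is "(?N has_derivative ?N') _")
    by (intro has_derivative_diff has_derivative_mult has_derivative_add has_derivative_const
        has_derivative_hermitian_inner F A B)
  moreover have "((\<lambda>y. (1 + hermitian_inner (F y) (F y)) * (1 + hermitian_inner (F y) (F y))) has_derivative
     (\<lambda>h. (1 + hermitian_inner (F x) (F x)) * (0 + (hermitian_inner (F x) (F' h) + hermitian_inner (F' h) (F x)))
        + (0 + (hermitian_inner (F x) (F' h) + hermitian_inner (F' h) (F x))) * (1 + hermitian_inner (F x) (F x)))) (at x)"
    by (intro has_derivative_mult has_derivative_add has_derivative_const
        has_derivative_hermitian_inner F)
  ultimately show ?thesis
    unfolding fs_hermitian_def power2_eq_square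
    apply (rule has_derivative_eq_rhs[OF has_derivative_divide'])
    using P[of "F x"] apply simp
    apply (rule ext)
    subgoal for h
      \<comment> \<open>Bilinearity reduces both sides to Hermitian products; a rational identity
        remains, with powers of \<open>1 + hermitian_inner (F x) (F x)\<close> as
        denominators.\<close>
      using P[of "F x"]
      by (simp add: fs_christoffel_def fs_coeff_def hermitian_inner_bilinear hermitian_inner_smult_left
        hermitian_inner_smult_right cnj_hermitian_inner) (simp add: divide_simps, simp add: algebra_simps)
    done
qed

lemma has_derivative_fubini_study:
  assumes "(F has_derivative F') (at x)" "(A has_derivative A') (at x)" "(B has_derivative B') (at x)"
  shows "((\<lambda>y. fubini_study (F y) (A y) (B y)) has_derivative
    (\<lambda>h. fubini_study (F x) (A' h + fs_christoffel (F x) (F' h) (A x)) (B x)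
       + fubini_study (F x) (A x) (B' h + fs_christoffel (F x) (F' h) (B x)))) (at x)"
  using has_derivative_Re[OF has_derivative_fs_hermitian[OF assms]]
  by (simp add: fubini_study_eq_Re)

lemma fubini_study_eqI:
  assumes "\<And>s. fubini_study w t s = fubini_study w t' s"
  shows "t = t'"
proof -
  have "fubini_study w (t - t') (t - t') = 0"
    by (subst (1) bounded_bilinear.diff_left[OF bounded_bilinear_fubini_study]) (simp add: assms)
  then show ?thesis by (simp add: fubini_study_eq_0_iff)
qed

text \<open>Compatibility for constant fields along the identity map evaluates each derivative in
  the Koszul formula, and the sum collapses because \<open>fs_christoffel\<close> is symmetric.
  Nondegeneracy of the metric gives uniqueness.\<close>

lemma christoffel_fubini_study: "christoffel fubini_study w u v = fs_christoffel w u v"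
proof -
  have "((\<lambda>y. fubini_study y a b) has_derivative (\<lambda>s. fubini_study w (fs_christoffel w s a) b
      + fubini_study w a (fs_christoffel w s b))) (at w)" for a b
    using has_derivative_fubini_study[OF has_derivative_ident has_derivative_const has_derivative_const,
        where x = w] by simp
  note D = frechet_derivative_at[OF this, symmetric]
  have K: "(frechet_derivative (\<lambda>y. fubini_study y v s) (at w) u
         + frechet_derivative (\<lambda>y. fubini_study y u s) (at w) v
         - frechet_derivative (\<lambda>y. fubini_study y u v) (at w) s) / 2 =
     fubini_study w (fs_christoffel w u v) s" for s
    unfolding D using fs_christoffel_commute[of w] fubini_study_commute[of w] by simp
  show ?thesis
    unfolding christoffel_def K by (rule the_equality) (auto intro: fubini_study_eqI)
qed

text \<open>The derivative of \<open>fs_christoffel w u v\<close> in the base point \<open>w\<close>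
  along \<open>h\<close>, with \<open>u\<close> and \<open>v\<close> held fixed; the next lemma
  confirms it.\<close>

definition fs_christoffel_deriv ::
  "complex ^ 'm \<Rightarrow> complex ^ 'm \<Rightarrow> complex ^ 'm \<Rightarrow> complex ^ 'm \<Rightarrow> complex ^ 'm" where
  "fs_christoffel_deriv w h u v =
     (\<chi> i. (hermitian_inner h w + hermitian_inner w h) / (1 + hermitian_inner w w)
          * (fs_coeff w u * v $ i + fs_coeff w v * u $ i)
        - (hermitian_inner u h * v $ i + hermitian_inner v h * u $ i) / (1 + hermitian_inner w w))"

lemma has_derivative_fs_christoffel:
  assumes F: "(F has_derivative F') (at x)"
    and A: "(A has_derivative A') (at x)" and B: "(B has_derivative B') (at x)"
  shows "((\<lambda>y. fs_christoffel (F y) (A y) (B y)) has_derivative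
    (\<lambda>h. fs_christoffel (F x) (A' h) (B x) + fs_christoffel (F x) (A x) (B' h)
      + fs_christoffel_deriv (F x) (F' h) (A x) (B x))) (at x)"
proof -
  note P = one_plus_hermitian_inner_self_nonzero
  have coeff: "((\<lambda>y. fs_coeff (F y) (A y)) has_derivative
      (\<lambda>h. ((hermitian_inner (A x) (F' h) + hermitian_inner (A' h) (F x)) * (1 + hermitian_inner (F x) (F x))
        - hermitian_inner (A x) (F x) * (0 + (hermitian_inner (F x) (F' h) + hermitian_inner (F' h) (F x))))
       / ((1 + hermitian_inner (F x) (F x)) * (1 + hermitian_inner (F x) (F x))))) (at x)"
    if A: "(A has_derivative A') (at x)" for A A'
    unfolding fs_coeff_def
    by (intro has_derivative_divide' has_derivative_add has_derivative_const
        has_derivative_hermitian_inner F A P)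
  show ?thesis
    unfolding fs_christoffel_def
    apply (rule has_derivative_eq_rhs[OF has_derivative_minus[OF has_derivative_add[OF
       bounded_bilinear.FDERIV[OF bounded_bilinear_vector_scalar_mult coeff[OF A] B]
       bounded_bilinear.FDERIV[OF bounded_bilinear_vector_scalar_mult coeff[OF B] A]]]])
    apply (rule ext)
    using P[of "F x"]
    by (simp add: vec_eq_iff fs_coeff_def fs_christoffel_deriv_def) (simp add: divide_simps, simp add: algebra_simps)
qed

text \<open>The left side is the curvature \<open>R(x, y) v\<close> in Christoffel symbols. The real
  and imaginary parts of \<open>fs_hermitian w v y\<close> are the metric products of
  \<open>v\<close> with \<open>y\<close> and with \<open>J y\<close>, so the right side is the usual
  tensor of constant holomorphic sectional curvature 4.\<close>

lemma fs_curvature: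
  "fs_christoffel_deriv w x y v + fs_christoffel w x (fs_christoffel w y v)
     - (fs_christoffel_deriv w y x v + fs_christoffel w y (fs_christoffel w x v)) =
   (fs_hermitian w x y - fs_hermitian w y x) *s v + fs_hermitian w v y *s x - fs_hermitian w v x *s y"
  using one_plus_hermitian_inner_self_nonzero[of w]
  by (simp add: vec_eq_iff fs_coeff_def fs_christoffel_deriv_def fs_christoffel_def fs_hermitian_def
      hermitian_inner_bilinear hermitian_inner_smult_left)
    (simp add: divide_simps, simp add: algebra_simps power2_eq_square)

section \<open>Immersions into an affine chart\<close>

lemma linear_eq_axis:
  fixes f g :: "real ^ 'n \<Rightarrow> 'b::real_vector"
  assumes "linear f" "linear g" "\<And>i. f (axis i 1) = g (axis i 1)"
  shows "f x = g x"
  using linear_eq_stdbasis[OF assms(1,2)] assms(3) by (auto simp: Basis_vec_def)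

section \<open>Smooth fields along a map and their orthogonal projections\<close>

lemma smooth_on_fubini_study:
  assumes W: "open W" and F: "smooth_on W F" and A: "smooth_on W A" and B: "smooth_on W B"
  shows "smooth_on W (\<lambda>u. fubini_study (F u) (A u) (B u))"
proof -
  note herm = smooth_on_bounded_bilinear[OF bounded_bilinear_hermitian_inner W]
  have P: "smooth_on W (\<lambda>u. 1 + Re (hermitian_inner (F u) (F u)))"
    by (intro smooth_on_add smooth_on_const smooth_on_bounded_linear[OF bounded_linear_Re] herm W F)
  \<comment> \<open>Norms give way to products and real parts, to which the closure rules for smooth
    maps apply.\<close>
  have eq: "fubini_study (F u) (A u) (B u) =
      Re (of_real (1 + Re (hermitian_inner (F u) (F u))) * hermitian_inner (A u) (B u)
          - hermitian_inner (A u) (F u) * hermitian_inner (F u) (B u))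
      / ((1 + Re (hermitian_inner (F u) (F u))) * (1 + Re (hermitian_inner (F u) (F u))))" for u
    by (simp add: fubini_study_def hermitian_inner_self power2_eq_square)
  have P0: "1 + Re (hermitian_inner (F u) (F u)) \<noteq> 0" for u
    using one_plus_norm_power2_pos[of "F u"] by (simp add: hermitian_inner_self)
  show ?thesis
    unfolding eq
    by (intro smooth_on_divide smooth_on_mult smooth_on_diff smooth_on_bounded_linear[OF bounded_linear_Re]
        smooth_on_bounded_linear[OF bounded_linear_of_real] herm P W A B F)
      (use P0 in auto)
qed

lemma smooth_on_fs_christoffel:
  assumes W: "open W" and F: "smooth_on W F" and A: "smooth_on W A" and B: "smooth_on W B"
  shows "smooth_on W (\<lambda>u. fs_christoffel (F u) (A u) (B u))"
proof -
  note herm = smooth_on_bounded_bilinear[OF bounded_bilinear_hermitian_inner W]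
  have P: "smooth_on W (\<lambda>u. 1 + Re (hermitian_inner (F u) (F u)))"
    by (intro smooth_on_add smooth_on_const smooth_on_bounded_linear[OF bounded_linear_Re] herm W F)
  have eq: "fs_christoffel (F u) (A u) (B u) = (- inverse (1 + Re (hermitian_inner (F u) (F u)))) *\<^sub>R
      (hermitian_inner (A u) (F u) *s B u + hermitian_inner (B u) (F u) *s A u)" for u
    by (simp add: fs_christoffel_def fs_coeff_def hermitian_inner_self vec_eq_iff scaleR_conv_of_real[where 'a = complex]
        divide_inverse algebra_simps)
  have "1 + Re (hermitian_inner (F u) (F u)) \<noteq> 0" for u
    using one_plus_norm_power2_pos[of "F u"] by (simp add: hermitian_inner_self)
  then show ?thesis
    unfolding eq
    by (intro smooth_on_scaleR smooth_on_uminus smooth_on_inverse P W smooth_on_add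
        smooth_on_bounded_bilinear[OF bounded_bilinear_vector_scalar_mult W] herm A B F)
qed

text \<open>Gram--Schmidt, one frame field at a time, keeping the coefficients smooth.\<close>
lemma smooth_orthogonal_decomposition:
  fixes E :: "'i \<Rightarrow> 'a::real_normed_vector \<Rightarrow> complex ^ 'm"
  assumes W: "open W" and F: "smooth_on W F" and "finite I"
    and "\<forall>i\<in>I. smooth_on W (E i)"
    and "\<forall>u\<in>W. \<forall>c. (\<Sum>i\<in>I. c i *\<^sub>R E i u) = 0 \<longrightarrow> (\<forall>i\<in>I. c i = 0)"
    and "smooth_on W V"
  shows "\<exists>c. (\<forall>i\<in>I. smooth_on W (c i)) \<and>
    (\<forall>u\<in>W. \<forall>j\<in>I. fubini_study (F u) (V u - (\<Sum>i\<in>I. c i u *\<^sub>R E i u)) (E j u) = 0)"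
  using assms(3-)
\<comment> \<open>\<open>V\<close> varies because the induction hypothesis serves twice, for
  \<open>V\<close> and for the new field \<open>E j\<close>.\<close>
proof (induction I arbitrary: V rule: finite_induct)
  case (insert j I)
  have indep: "\<forall>u\<in>W. \<forall>c. (\<Sum>i\<in>I. c i *\<^sub>R E i u) = 0 \<longrightarrow> (\<forall>i\<in>I. c i = 0)"
  proof (intro ballI allI impI)
    fix u c i assume that: "u \<in> W" "(\<Sum>i\<in>I. c i *\<^sub>R E i u) = 0" and i: "i \<in> I"
    have "(\<Sum>i\<in>insert j I. (c(j := 0)) i *\<^sub>R E i u) = (\<Sum>i\<in>I. c i *\<^sub>R E i u)"
      using insert.hyps by (simp, intro sum.cong) auto
    then have "(\<Sum>i\<in>insert j I. (c(j := 0)) i *\<^sub>R E i u) = 0"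
      using that(2) by (rule trans)
    from insert.prems(2)[rule_format, OF that(1) this insertI2[OF i]] have "(c(j := 0)) i = 0" .
    then show "c i = 0"
      using i insert.hyps(2) by (auto split: if_splits)
  qed
  have smooth: "\<forall>i\<in>I. smooth_on W (E i)"
    using insert.prems(1) by simp
  have Ej: "smooth_on W (E j)"
    using insert.prems(1) by simp
  obtain c where c: "\<forall>i\<in>I. smooth_on W (c i)"
    "\<forall>u\<in>W. \<forall>k\<in>I. fubini_study (F u) (V u - (\<Sum>i\<in>I. c i u *\<^sub>R E i u)) (E k u) = 0"
    using insert.IH[OF smooth indep insert.prems(3)] by blast
  obtain d where d: "\<forall>i\<in>I. smooth_on W (d i)"
    "\<forall>u\<in>W. \<forall>k\<in>I. fubini_study (F u) (E j u - (\<Sum>i\<in>I. d i u *\<^sub>R E i u)) (E k u) = 0"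
    using insert.IH[OF smooth indep Ej] by blast
  \<comment> \<open>The residuals of \<open>V\<close> and of \<open>E j\<close> after projection to
    the old fields; \<open>q\<close> is the coefficient of \<open>V'\<close> along
    \<open>E'\<close>.\<close>
  define V' where "V' = (\<lambda>u. V u - (\<Sum>i\<in>I. c i u *\<^sub>R E i u))"
  define E' where "E' = (\<lambda>u. E j u - (\<Sum>i\<in>I. d i u *\<^sub>R E i u))"
  define q where "q = (\<lambda>u. fubini_study (F u) (V' u) (E' u) / fubini_study (F u) (E' u) (E' u))"
  \<comment> \<open>A zero of \<open>E'\<close> would be a linear relation among the fields with
    coefficient 1 at \<open>j\<close>.\<close>
  have E'_nonzero: "E' u \<noteq> 0" if "u \<in> W" for u
  proof
    assume "E' u = 0"
    moreover have "(\<Sum>i\<in>insert j I. (if i = j then 1 else - d i u) *\<^sub>R E i u) = E' u"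
    proof -
      have "(\<Sum>i\<in>I. (if i = j then 1 else - d i u) *\<^sub>R E i u) = (\<Sum>i\<in>I. - (d i u *\<^sub>R E i u))"
        using insert.hyps(2) by (intro sum.cong) auto
      then show ?thesis
        using insert.hyps by (simp add: E'_def sum_negf)
    qed
    ultimately have "(\<Sum>i\<in>insert j I. (if i = j then 1 else - d i u) *\<^sub>R E i u) = 0"
      by simp
    from insert.prems(2)[rule_format, OF that this, of j] show False
      by simp
  qed
  have "smooth_on W V'" "smooth_on W E'"
    unfolding V'_def E'_def using c(1) d(1) smooth
    by (auto intro!: smooth_on_diff smooth_on_sum smooth_on_scaleR W insert.prems(3) Ej)
  then have q: "smooth_on W q"
    unfolding q_def
    by (intro smooth_on_divide smooth_on_fubini_study W F) (simp_all add: fubini_study_eq_0_iff E'_nonzero)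
  \<comment> \<open>Expanding \<open>q u *\<^sub>R E' u\<close> in the original fields gives the
    coefficient \<open>q u\<close> at \<open>j\<close> and corrects each older one by
    \<open>- q u * d i u\<close>.\<close>
  define c' where "c' = (\<lambda>i u. if i = j then q u else c i u - q u * d i u)"
  have c': "smooth_on W (c' i)" if "i \<in> insert j I" for i
  proof (cases "i = j")
    case False
    then show ?thesis
      using that c(1) d(1) q unfolding c'_def by (auto intro!: smooth_on_diff smooth_on_mult W)
  qed (use q in \<open>simp add: c'_def\<close>)
  have decomp: "V u - (\<Sum>i\<in>insert j I. c' i u *\<^sub>R E i u) = V' u - q u *\<^sub>R E' u" for u
  proof -
    have "(\<Sum>i\<in>I. c' i u *\<^sub>R E i u) = (\<Sum>i\<in>I. c i u *\<^sub>R E i u - q u *\<^sub>R (d i u *\<^sub>R E i u))"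
      using insert.hyps(2) by (intro sum.cong) (auto simp: c'_def algebra_simps)
    then show ?thesis
      using insert.hyps
      by (simp add: V'_def E'_def sum_subtractf scaleR_sum_right c'_def algebra_simps)
  qed
  have V'_orth: "fubini_study (F u) (V' u) (E k u) = 0"
    and E'_orth: "fubini_study (F u) (E' u) (E k u) = 0" if "u \<in> W" "k \<in> I" for u k
    using c(2) d(2) that unfolding V'_def E'_def by blast+
  have orth: "fubini_study (F u) (V' u - q u *\<^sub>R E' u) (E k u) = 0" if "u \<in> W" "k \<in> insert j I" for u k
  proof (cases "k \<in> I")
    case True
    then show ?thesis
      using V'_orth E'_orth that(1) by (simp add: fubini_study_bilinear)
  next
    case False
    then have "E k u = E' u + (\<Sum>i\<in>I. d i u *\<^sub>R E i u)"
      using that by (simp add: E'_def)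
    moreover have "fubini_study (F u) (V' u - q u *\<^sub>R E' u) (\<Sum>i\<in>I. d i u *\<^sub>R E i u) = 0"
      using V'_orth E'_orth that(1) by (simp add: fubini_study_bilinear)
    moreover have "fubini_study (F u) (V' u - q u *\<^sub>R E' u) (E' u) = 0"
      using E'_nonzero[OF that(1)]
      by (simp add: q_def fubini_study_bilinear fubini_study_eq_0_iff)
    ultimately show ?thesis
      by (simp add: fubini_study_bilinear(2))
  qed
  show ?case
    using c' decomp orth by (intro exI[of _ c']) auto
qed simp

section \<open>The ambient connection along one coordinate representation of an immersion\<close>

locale local_immersion =
  fixes F :: "real ^ 'n \<Rightarrow> complex ^ 'm" and W :: "(real ^ 'n) set"
  assumes open_W: "open W"
    and smooth_F: "smooth_on W F"
    and inj_F: "u \<in> W \<Longrightarrow> inj (frechet_derivative F (at u))"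
begin

text \<open>The direction precedes the base point so that \<open>dF b\<close> is itself a vector
  field along \<open>F\<close>.\<close>

abbreviation dF :: "real ^ 'n \<Rightarrow> real ^ 'n \<Rightarrow> complex ^ 'm" where
  "dF b u \<equiv> frechet_derivative F (at u) b"

abbreviation cov :: "real ^ 'n \<Rightarrow> (real ^ 'n \<Rightarrow> complex ^ 'm) \<Rightarrow> real ^ 'n \<Rightarrow> complex ^ 'm" where
  "cov \<equiv> cov_deriv fubini_study F"

lemma linear_dF: "u \<in> W \<Longrightarrow> linear (\<lambda>b. dF b u)"
  using has_derivative_linear[OF smooth_on_has_derivative[OF smooth_F]] by simp

lemma smooth_dF: "smooth_on W (dF b)"
  by (rule smooth_on_frechet_derivative[OF smooth_F])

lemma dF_eq_0: "u \<in> W \<Longrightarrow> dF b u = 0 \<Longrightarrow> b = 0"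
  using linear_injective_0[OF linear_dF] inj_F by blast

lemma sum_dF_axis: "u \<in> W \<Longrightarrow> (\<Sum>i\<in>UNIV. c i *\<^sub>R dF (axis i 1) u) = dF (\<chi> i. c i) u"
proof -
  assume u: "u \<in> W"
  have "(\<chi> i. c i) = (\<Sum>i\<in>UNIV. c i *\<^sub>R axis i 1 :: real ^ 'n)"
    by (simp add: vec_eq_iff axis_def if_distrib cong: if_cong)
  then show ?thesis
    by (simp only: linear_sum[OF linear_dF[OF u]] linear_cmul[OF linear_dF[OF u]])
qed

lemma cov_eq:
  assumes "(V has_derivative V') (at u)"
  shows "cov a V u = V' a + fs_christoffel (F u) (dF a u) (V u)"
  by (simp add: cov_deriv_def christoffel_fubini_study frechet_derivative_at[OF assms, symmetric])

lemma smooth_cov: "smooth_on W V \<Longrightarrow> smooth_on W (cov a V)"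
  unfolding cov_deriv_def christoffel_fubini_study
  by (intro smooth_on_add smooth_on_frechet_derivative smooth_on_fs_christoffel open_W smooth_F smooth_dF)

text \<open>Torsion-freeness for constant, hence commuting, coordinate fields: second derivatives
  and Christoffel symbols are both symmetric.\<close>

lemma cov_commute: "u \<in> W \<Longrightarrow> cov a (dF b) u = cov b (dF a) u"
  using frechet_derivative_commute[OF open_W smooth_F, of u b a] fs_christoffel_commute
  by (simp add: cov_deriv_def christoffel_fubini_study)

text \<open>\<open>b\<close> sits inside the field being differentiated; \<open>cov_commute\<close>
  moves it into the direction, where linearity is that of a derivative.\<close>

lemma linear_cov_dF: "u \<in> W \<Longrightarrow> linear (\<lambda>b. cov a (dF b) u)"
proof -
  assume u: "u \<in> W"
  have "linear (\<lambda>b. frechet_derivative (dF a) (at u) b + fs_christoffel (F u) (dF b u) (dF a u))"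
  proof (rule linear_compose_add)
    show "linear (\<lambda>b. frechet_derivative (dF a) (at u) b)"
      using has_derivative_linear[OF smooth_on_has_derivative[OF smooth_dF u]] by simp
    show "linear (\<lambda>b. fs_christoffel (F u) (dF b u) (dF a u))"
      using linear_compose[OF linear_dF[OF u] bounded_linear.linear[OF
          bounded_bilinear.bounded_linear_left[OF bounded_bilinear_fs_christoffel]]]
      by (simp add: comp_def)
  qed
  then show ?thesis
    using cov_commute[OF u, of a] by (simp add: cov_deriv_def christoffel_fubini_study)
qed

section \<open>Tangent and normal spaces and the normal projection\<close>

lemma tangent_sp_eq: "tangent_sp F u = range (\<lambda>b. dF b u)"
  by (simp add: tangent_sp_def)

lemma subspace_tangent_sp: "u \<in> W \<Longrightarrow> subspace (tangent_sp F u)"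
  unfolding tangent_sp_eq by (rule linear_subspace_image[OF linear_dF subspace_UNIV])

lemma subspace_normal_sp: "subspace (normal_sp fubini_study F u)"
  by (auto simp: subspace_def normal_sp_def fubini_study_bilinear)

lemma normal_sp_iff: "v \<in> normal_sp fubini_study F u \<longleftrightarrow> (\<forall>b. fubini_study (F u) v (dF b u) = 0)"
  by (auto simp: normal_sp_def tangent_sp_eq)

lemma tangent_normal_eq_0:
  "v \<in> tangent_sp F u \<Longrightarrow> v \<in> normal_sp fubini_study F u \<Longrightarrow> v = 0"
  using fubini_study_eq_0_iff[of "F u" v] by (auto simp: normal_sp_def)

text \<open>Injectivity of the differential makes the coordinate frame independent, so Gram--Schmidt
  supplies smooth tangential coefficients. Orthogonality to the frame extends to all tangent vectors
  by linearity.\<close>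

lemma smooth_normal_decomposition:
  assumes V: "smooth_on W V"
  shows "\<exists>c. (\<forall>i. smooth_on W (c i)) \<and>
    (\<forall>u\<in>W. V u - (\<Sum>i\<in>UNIV. c i u *\<^sub>R dF (axis i 1) u) \<in> normal_sp fubini_study F u)"
proof -
  have "\<forall>u\<in>W. \<forall>c. (\<Sum>i\<in>UNIV. c i *\<^sub>R dF (axis i 1) u) = 0 \<longrightarrow> (\<forall>i\<in>UNIV. c i = 0)"
  proof (intro ballI allI impI)
    fix u c i assume "u \<in> W" "(\<Sum>i\<in>UNIV. c i *\<^sub>R dF (axis i 1) u) = 0"
    then have "(\<chi> i. c i) = 0"
      using dF_eq_0 by (simp add: sum_dF_axis)
    then show "c i = 0"
      by (simp add: vec_eq_iff)
  qed
  from smooth_orthogonal_decomposition[OF open_W smooth_F finite _ this V] smooth_dF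
  obtain c where c: "\<forall>i. smooth_on W (c i)"
    "\<forall>u\<in>W. \<forall>j. fubini_study (F u) (V u - (\<Sum>i\<in>UNIV. c i u *\<^sub>R dF (axis i 1) u)) (dF (axis j 1) u) = 0"
    by auto
  have "V u - (\<Sum>i\<in>UNIV. c i u *\<^sub>R dF (axis i 1) u) \<in> normal_sp fubini_study F u" (is "?N \<in> _")
    if u: "u \<in> W" for u
    unfolding normal_sp_iff
  proof
    fix b
    have "linear (\<lambda>b. fubini_study (F u) ?N (dF b u))"
      using linear_compose[OF linear_dF[OF u] bounded_linear.linear[OF
          bounded_bilinear.bounded_linear_right[OF bounded_bilinear_fubini_study]]]
      by (simp add: comp_def)
    from linear_eq_axis[OF this linear_zero]
    show "fubini_study (F u) ?N (dF b u) = 0"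
      using c(2) u by blast
  qed
  then show ?thesis
    using c(1) by blast
qed

lemma normal_part_eqI:
  assumes u: "u \<in> W" and w: "w \<in> normal_sp fubini_study F u" "v - w \<in> tangent_sp F u"
  shows "normal_part fubini_study F u v = w"
  unfolding normal_part_def
proof (rule the_equality)
  show "w \<in> normal_sp fubini_study F u \<and> v - w \<in> tangent_sp F u" using w by simp
next
  fix w' assume w': "w' \<in> normal_sp fubini_study F u \<and> v - w' \<in> tangent_sp F u"
  have "w - w' \<in> tangent_sp F u"
    using subspace_diff[OF subspace_tangent_sp[OF u], of "v - w'" "v - w"] w w' by simp
  moreover have "w - w' \<in> normal_sp fubini_study F u"
    using subspace_diff[OF subspace_normal_sp] w w' by blast
  ultimately show "w' = w"
    using tangent_normal_eq_0 by (metis eq_iff_diff_eq_0)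
qed

lemma normal_part_tangent:
  assumes u: "u \<in> W"
  shows "v - normal_part fubini_study F u v \<in> tangent_sp F u"
proof -
  obtain c where "\<And>i. smooth_on W (c i)"
    "\<And>y. y \<in> W \<Longrightarrow> v - (\<Sum>i\<in>UNIV. c i y *\<^sub>R dF (axis i 1) y) \<in> normal_sp fubini_study F y"
    \<comment> \<open>Existence of the splitting at \<open>u\<close> comes from the constant
      coordinate field with value \<open>v\<close>.\<close>
    using smooth_normal_decomposition[OF smooth_on_const[OF open_W, of v]] by blast
  then have c: "v - (\<Sum>i\<in>UNIV. c i u *\<^sub>R dF (axis i 1) u) \<in> normal_sp fubini_study F u"
    using u by blast
  moreover have "v - (v - (\<Sum>i\<in>UNIV. c i u *\<^sub>R dF (axis i 1) u)) \<in> tangent_sp F u"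
    using u by (simp add: sum_dF_axis tangent_sp_eq)
  ultimately show "v - normal_part fubini_study F u v \<in> tangent_sp F u"
    using normal_part_eqI[OF u c] by simp
qed

lemma fubini_study_normal_part:
  assumes u: "u \<in> W" and \<eta>: "\<eta> \<in> normal_sp fubini_study F u"
  shows "fubini_study (F u) (normal_part fubini_study F u v) \<eta> = fubini_study (F u) v \<eta>"
proof -
  have "fubini_study (F u) \<eta> (v - normal_part fubini_study F u v) = 0"
    using \<eta> normal_part_tangent[OF u] by (auto simp: normal_sp_def)
  then show ?thesis
    by (simp add: fubini_study_bilinear fubini_study_commute)
qed

text \<open>Flatness speaks of normal fields, the argument of a single normal vector. The constant
  coordinate field \<open>v\<close> loses its tangential part everywhere, and at \<open>u\<close>
  that part is zero.\<close>

lemma normal_field_extension: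
  assumes u: "u \<in> W" and v: "v \<in> normal_sp fubini_study F u"
  shows "\<exists>\<nu>. smooth_on W \<nu> \<and> (\<forall>y\<in>W. \<nu> y \<in> normal_sp fubini_study F y) \<and> \<nu> u = v"
proof -
  obtain c where c: "\<And>i. smooth_on W (c i)"
    "\<And>y. y \<in> W \<Longrightarrow> v - (\<Sum>i\<in>UNIV. c i y *\<^sub>R dF (axis i 1) y) \<in> normal_sp fubini_study F y"
    using smooth_normal_decomposition[OF smooth_on_const[OF open_W, of v]] by blast
  have "(\<Sum>i\<in>UNIV. c i u *\<^sub>R dF (axis i 1) u) = 0"
  proof (rule tangent_normal_eq_0)
    show "(\<Sum>i\<in>UNIV. c i u *\<^sub>R dF (axis i 1) u) \<in> tangent_sp F u"
      using u by (simp add: sum_dF_axis tangent_sp_eq)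
    show "(\<Sum>i\<in>UNIV. c i u *\<^sub>R dF (axis i 1) u) \<in> normal_sp fubini_study F u"
      using subspace_diff[OF subspace_normal_sp v c(2)[OF u]] by simp
  qed
  then have "v - (\<Sum>i\<in>UNIV. c i u *\<^sub>R dF (axis i 1) u) = v"
    by simp
  moreover have "smooth_on W (\<lambda>y. v - (\<Sum>i\<in>UNIV. c i y *\<^sub>R dF (axis i 1) y))"
    by (intro smooth_on_diff smooth_on_const smooth_on_sum smooth_on_scaleR c(1) smooth_dF open_W)
  ultimately show ?thesis
    using c(2) by (intro exI[of _ "\<lambda>y. v - (\<Sum>i\<in>UNIV. c i y *\<^sub>R dF (axis i 1) y)"] conjI ballI)
qed

section \<open>Umbilical normals and the Ricci equation\<close>

lemma metric_compatible:
  assumes "smooth_on W A" "smooth_on W B" "u \<in> W"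
  shows "((\<lambda>y. fubini_study (F y) (A y) (B y)) has_derivative
    (\<lambda>a. fubini_study (F u) (cov a A u) (B u) + fubini_study (F u) (A u) (cov a B u))) (at u)"
  unfolding cov_deriv_def christoffel_fubini_study
  by (intro has_derivative_fubini_study smooth_on_has_derivative[of W] assms smooth_F)

text \<open>The Weingarten relation, from differentiating the vanishing product of
  \<open>\<nu>\<close> and \<open>dF b\<close>.\<close>

lemma fubini_study_cov_normal:
  assumes \<nu>: "smooth_on W \<nu>" "\<And>y. y \<in> W \<Longrightarrow> \<nu> y \<in> normal_sp fubini_study F y" and u: "u \<in> W"
  shows "fubini_study (F u) (cov a \<nu> u) (dF b u) = - fubini_study (F u) (\<nu> u) (cov a (dF b) u)"
proof -
  have "((\<lambda>y. 0) has_derivative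
    (\<lambda>a. fubini_study (F u) (cov a \<nu> u) (dF b u) + fubini_study (F u) (\<nu> u) (cov a (dF b) u))) (at u)"
    by (rule has_derivative_transform_within_open[OF metric_compatible[OF \<nu>(1) smooth_dF u] open_W u])
      (use \<nu>(2) in \<open>simp add: normal_sp_iff\<close>)
  from fun_cong[OF has_derivative_unique[OF this has_derivative_const], of a] show ?thesis
    by linarith
qed

text \<open>\<open>shape_op\<close> is a definite description, so its defining equation must first
  be shown uniquely solvable; then umbilicity makes the second fundamental form along
  \<open>\<eta>\<close> a multiple of the metric.\<close>

lemma umbilical_normal_second_fund:
  assumes u: "u \<in> W" and \<eta>: "umbilical_normal fubini_study F u \<eta>"
  shows "\<exists>l. \<forall>a b. fubini_study (F u) (cov a (dF b) u) \<eta> = l * fubini_study (F u) (dF a u) (dF b u)"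
proof -
  have \<eta>n: "\<eta> \<in> normal_sp fubini_study F u"
    using \<eta> by (simp add: umbilical_normal_def)
  have II: "fubini_study (F u) (second_fund fubini_study F u a b) \<eta> = fubini_study (F u) (cov a (dF b) u) \<eta>" for a b
    by (simp add: second_fund_def fubini_study_normal_part[OF u \<eta>n])
  have lin_right: "linear (\<lambda>b. fubini_study (F u) v (dF b u))" for v
    using linear_compose[OF linear_dF[OF u] bounded_linear.linear[OF
        bounded_bilinear.bounded_linear_right[OF bounded_bilinear_fubini_study]]]
    by (simp add: comp_def)
  have lin_II: "linear (\<lambda>b. fubini_study (F u) (cov a (dF b) u) \<eta>)" for a
    using linear_compose[OF linear_cov_dF[OF u] bounded_linear.linear[OF
        bounded_bilinear.bounded_linear_left[OF bounded_bilinear_fubini_study]]]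
    by (simp add: comp_def)
  have "\<exists>!c. \<forall>b. first_fund fubini_study F u c b = fubini_study (F u) (second_fund fubini_study F u a b) \<eta>" for a
  proof (rule ex_ex1I)
    \<comment> \<open>The Gram map of the coordinate frame: injective because the metric is
      definite, hence surjective in finite dimension, so a solution \<open>c\<close> exists.\<close>
    define T where "T = (\<lambda>c. \<chi> i. fubini_study (F u) (dF c u) (dF (axis i 1) u) :: real ^ 'n)"
    have T: "linear T"
      unfolding T_def
      by (auto simp: linear_iff vec_eq_iff linear_add[OF linear_dF[OF u]] linear_cmul[OF linear_dF[OF u]]
          fubini_study_bilinear)
    have "inj T"
      unfolding linear_injective_0[OF T]
    proof (intro allI impI)
      fix c assume "T c = 0"
      then have "fubini_study (F u) (dF c u) (dF (axis i 1) u) = 0" for i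
        by (simp add: T_def vec_eq_iff)
      from linear_eq_axis[OF lin_right linear_zero this, of c] show "c = 0"
        by (intro dF_eq_0[OF u]) (simp only: fubini_study_eq_0_iff)
    qed
    then have "surj T"
      using linear_injective_imp_surjective[OF T] by simp
    then obtain c where c: "(\<chi> i. fubini_study (F u) (cov a (dF (axis i 1)) u) \<eta>) = T c"
      by (rule surjE)
    have "fubini_study (F u) (dF c u) (dF b u) = fubini_study (F u) (cov a (dF b) u) \<eta>" for b
      by (rule linear_eq_axis[OF lin_right lin_II]) (use c in \<open>simp add: T_def vec_eq_iff\<close>)
    then show "\<exists>c. \<forall>b. first_fund fubini_study F u c b = fubini_study (F u) (second_fund fubini_study F u a b) \<eta>"
      unfolding II first_fund_def by (intro exI allI)
  next
    fix c c'
    assume "\<forall>b. first_fund fubini_study F u c b = fubini_study (F u) (second_fund fubini_study F u a b) \<eta>"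
      "\<forall>b. first_fund fubini_study F u c' b = fubini_study (F u) (second_fund fubini_study F u a b) \<eta>"
    then have "fubini_study (F u) (dF (c - c') u) (dF b u) = 0" for b
      by (simp add: first_fund_def linear_diff[OF linear_dF[OF u]] fubini_study_bilinear)
    from this[of "c - c'"] have "dF (c - c') u = 0"
      by (simp only: fubini_study_eq_0_iff)
    from dF_eq_0[OF u this] show "c = c'"
      by simp
  qed
  then have "\<forall>b. first_fund fubini_study F u (shape_op fubini_study F u \<eta> a) b =
      fubini_study (F u) (second_fund fubini_study F u a b) \<eta>" for a
    unfolding shape_op_def by (rule theI')
  then have shape: "first_fund fubini_study F u (shape_op fubini_study F u \<eta> a) b =
      fubini_study (F u) (cov a (dF b) u) \<eta>" for a b
    unfolding II by (rule spec)
  have "fubini_study (F u) (cov a (dF b) u) \<eta> =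
      fubini_study (F u) \<eta> (mean_curvature fubini_study F u) * fubini_study (F u) (dF a u) (dF b u)" for a b
  proof -
    have "shape_op fubini_study F u \<eta> a = fubini_study (F u) \<eta> (mean_curvature fubini_study F u) *\<^sub>R a"
      using \<eta> by (simp only: umbilical_normal_def)
    then show ?thesis
      unfolding shape[symmetric]
      by (simp only: first_fund_def linear_cmul[OF linear_dF[OF u]] fubini_study_bilinear real_scaleR_def)
  qed
  then show ?thesis
    by (intro exI allI)
qed

text \<open>For an umbilical direction the correction term is symmetric in \<open>a\<close> and \<open>b\<close>, so it drops out of
  the Ricci equation.\<close>
lemma second_normal_derivative:
  assumes \<nu>: "smooth_on W \<nu>" "\<And>y. y \<in> W \<Longrightarrow> \<nu> y \<in> normal_sp fubini_study F y" and u: "u \<in> W"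
    and \<eta>: "\<eta> \<in> normal_sp fubini_study F u"
    and l: "\<And>a b. fubini_study (F u) (cov a (dF b) u) \<eta> = l * fubini_study (F u) (dF a u) (dF b u)"
  shows "fubini_study (F u) (normal_conn fubini_study F (\<lambda>_. a) (normal_conn fubini_study F (\<lambda>_. b) \<nu>) u) \<eta> =
    fubini_study (F u) (cov a (cov b \<nu>) u) \<eta> + l * fubini_study (F u) (\<nu> u) (cov b (dF a) u)"
proof -
  have V: "smooth_on W (cov b \<nu>)" by (rule smooth_cov[OF \<nu>(1)])
  obtain c where c: "\<And>i. smooth_on W (c i)"
    "\<And>y. y \<in> W \<Longrightarrow> cov b \<nu> y - (\<Sum>i\<in>UNIV. c i y *\<^sub>R dF (axis i 1) y) \<in> normal_sp fubini_study F y"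
    using smooth_normal_decomposition[OF V] by blast
  \<comment> \<open>An explicit formula for the normal derivative of \<open>\<nu>\<close> on all of
    \<open>W\<close>, with smooth coefficients, so that it can be differentiated again.\<close>
  define N where "N = (\<lambda>y. cov b \<nu> y - (\<Sum>i\<in>UNIV. c i y *\<^sub>R dF (axis i 1) y))"
  have N: "normal_conn fubini_study F (\<lambda>_. b) \<nu> y = N y" if "y \<in> W" for y
    unfolding normal_conn_def
    by (rule normal_part_eqI[OF that]) (use c(2) that in \<open>auto simp: N_def sum_dF_axis tangent_sp_eq\<close>)
  have "(N has_derivative (\<lambda>h. frechet_derivative (cov b \<nu>) (at u) h -
      (\<Sum>i\<in>UNIV. c i u *\<^sub>R frechet_derivative (dF (axis i 1)) (at u) h
         + frechet_derivative (c i) (at u) h *\<^sub>R dF (axis i 1) u))) (at u)"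
    unfolding N_def
    by (intro has_derivative_diff has_derivative_sum has_derivative_scaleR
        smooth_on_has_derivative[of W] V c(1) smooth_dF u)
  from has_derivative_transform_within_open[OF this open_W u N[symmetric]]
  have "cov a (normal_conn fubini_study F (\<lambda>_. b) \<nu>) u =
     frechet_derivative (cov b \<nu>) (at u) a -
      (\<Sum>i\<in>UNIV. c i u *\<^sub>R frechet_derivative (dF (axis i 1)) (at u) a
         + frechet_derivative (c i) (at u) a *\<^sub>R dF (axis i 1) u) + fs_christoffel (F u) (dF a u) (N u)"
    by (subst cov_eq) (auto simp: N[OF u])
  \<comment> \<open>Derivatives of the coefficients contribute only tangent vectors, which vanish
    against \<open>\<eta>\<close>.\<close>
  also have "\<dots> = cov a (cov b \<nu>) u - (\<Sum>i\<in>UNIV. c i u *\<^sub>R cov a (dF (axis i 1)) u)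
      - (\<Sum>i\<in>UNIV. frechet_derivative (c i) (at u) a *\<^sub>R dF (axis i 1) u)"
    unfolding N_def cov_deriv_def[of _ _ a] christoffel_fubini_study
    by (simp add: bounded_bilinear.diff_right[OF bounded_bilinear_fs_christoffel]
        bounded_bilinear.sum_right[OF bounded_bilinear_fs_christoffel]
        bounded_bilinear.scaleR_right[OF bounded_bilinear_fs_christoffel] sum.distrib scaleR_add_right)
  finally have cov: "cov a (normal_conn fubini_study F (\<lambda>_. b) \<nu>) u = \<dots>" .
  have \<eta>_dF: "fubini_study (F u) (dF b u) \<eta> = 0" for b
    using \<eta> fubini_study_commute[of "F u" "dF b u" \<eta>] by (simp only: normal_sp_iff)
  \<comment> \<open>The coefficients \<open>c\<close> enter only through the product of the
    tangential part of \<open>cov b \<nu>\<close> with \<open>dF a\<close>, which the Weingarten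
    relation expresses by \<open>\<nu>\<close>.\<close>
  have "fubini_study (F u) (cov b \<nu> u - (\<Sum>i\<in>UNIV. c i u *\<^sub>R dF (axis i 1) u)) (dF a u) = 0"
    using c(2)[OF u] by (simp add: normal_sp_iff)
  then have "(\<Sum>i\<in>UNIV. c i u * fubini_study (F u) (dF (axis i 1) u) (dF a u)) =
      - fubini_study (F u) (\<nu> u) (cov b (dF a) u)"
    using fubini_study_cov_normal[OF \<nu> u, of b a] by (simp add: fubini_study_bilinear)
  moreover have "(\<Sum>i\<in>UNIV. c i u * (l * fubini_study (F u) (dF a u) (dF (axis i 1) u))) =
      l * (\<Sum>i\<in>UNIV. c i u * fubini_study (F u) (dF (axis i 1) u) (dF a u))"
    unfolding sum_distrib_left fubini_study_commute[of "F u" "dF a u"]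
    by (intro sum.cong refl mult.left_commute)
  ultimately have "(\<Sum>i\<in>UNIV. c i u * fubini_study (F u) (cov a (dF (axis i 1)) u) \<eta>) =
      - (l * fubini_study (F u) (\<nu> u) (cov b (dF a) u))"
    unfolding l by simp
  then show ?thesis
    unfolding normal_conn_def[of _ _ "\<lambda>_. a"] fubini_study_normal_part[OF u \<eta>] cov
    by (simp add: fubini_study_bilinear \<eta>_dF)
qed

text \<open>For constant directions the commutator is the ambient curvature: second derivatives of
  \<open>\<nu>\<close> and \<open>F\<close> cancel by symmetry, and the Christoffel terms left over
  are those of \<open>fs_curvature\<close>.\<close>

lemma cov_cov_commutator:
  assumes \<nu>: "smooth_on W \<nu>" and u: "u \<in> W"
  shows "cov a (cov b \<nu>) u - cov b (cov a \<nu>) u =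
    (fs_hermitian (F u) (dF a u) (dF b u) - fs_hermitian (F u) (dF b u) (dF a u)) *s \<nu> u
      + fs_hermitian (F u) (\<nu> u) (dF b u) *s dF a u - fs_hermitian (F u) (\<nu> u) (dF a u) *s dF b u"
proof -
  have cc: "cov a (cov b \<nu>) u =
      frechet_derivative (\<lambda>y. frechet_derivative \<nu> (at y) b) (at u) a
      + (fs_christoffel (F u) (frechet_derivative (dF b) (at u) a) (\<nu> u)
        + fs_christoffel (F u) (dF b u) (frechet_derivative \<nu> (at u) a)
        + fs_christoffel_deriv (F u) (dF a u) (dF b u) (\<nu> u))
      + (fs_christoffel (F u) (dF a u) (frechet_derivative \<nu> (at u) b)
         + fs_christoffel (F u) (dF a u) (fs_christoffel (F u) (dF b u) (\<nu> u)))" for a b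
  proof -
    have "(cov b \<nu> has_derivative (\<lambda>h. frechet_derivative (\<lambda>y. frechet_derivative \<nu> (at y) b) (at u) h
      + (fs_christoffel (F u) (frechet_derivative (dF b) (at u) h) (\<nu> u)
        + fs_christoffel (F u) (dF b u) (frechet_derivative \<nu> (at u) h)
        + fs_christoffel_deriv (F u) (dF h u) (dF b u) (\<nu> u)))) (at u)"
      unfolding cov_deriv_def christoffel_fubini_study
      by (intro has_derivative_add has_derivative_fs_christoffel smooth_on_has_derivative[of W]
          smooth_on_frechet_derivative \<nu> smooth_F u)
    from cov_eq[OF this, of a] show ?thesis
      by (simp add: cov_deriv_def[of _ _ b] christoffel_fubini_study
          bounded_bilinear.add_right[OF bounded_bilinear_fs_christoffel])
  qed
  show ?thesis
    unfolding cc fs_curvature[symmetric]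
      frechet_derivative_commute[OF open_W \<nu> u, of a b]
      frechet_derivative_commute[OF open_W smooth_F u, of a b]
    by simp
qed

text \<open>The Ricci equation for a flat normal connection: for umbilical \<open>\<eta>\<close> the
  commutator of shape operators contributes nothing, so the ambient curvature term alone must
  vanish.\<close>

lemma ricci_umbilical:
  assumes flat: "\<forall>X Y \<nu>. smooth_on W X \<and> smooth_on W Y \<and> smooth_on W \<nu> \<and>
      (\<forall>y\<in>W. \<nu> y \<in> normal_sp fubini_study F y) \<longrightarrow> normal_curvature fubini_study F X Y \<nu> u = 0"
    and u: "u \<in> W" and \<eta>: "umbilical_normal fubini_study F u \<eta>"
    and v: "v \<in> normal_sp fubini_study F u"
    and x: "x \<in> tangent_sp F u" and y: "y \<in> tangent_sp F u"
  shows "fubini_study (F u) ((fs_hermitian (F u) x y - fs_hermitian (F u) y x) *s v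
      + fs_hermitian (F u) v y *s x - fs_hermitian (F u) v x *s y) \<eta> = 0"
proof -
  have \<eta>n: "\<eta> \<in> normal_sp fubini_study F u"
    using \<eta> by (simp add: umbilical_normal_def)
  obtain a b where ab: "x = dF a u" "y = dF b u"
    using x y by (auto simp: tangent_sp_eq)
  obtain \<nu> where \<nu>: "smooth_on W \<nu>" "\<And>y. y \<in> W \<Longrightarrow> \<nu> y \<in> normal_sp fubini_study F y" "\<nu> u = v"
    using normal_field_extension[OF u v] by blast
  obtain l where l: "\<And>a b. fubini_study (F u) (cov a (dF b) u) \<eta> = l * fubini_study (F u) (dF a u) (dF b u)"
    using umbilical_normal_second_fund[OF u \<eta>] by blast
  \<comment> \<open>Extending \<open>a\<close> and \<open>b\<close> to constant fields makes their
    bracket zero, which removes the third term of the normal curvature.\<close>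
  have "normal_conn fubini_study F (lie_bracket (\<lambda>_. a) (\<lambda>_. b)) \<nu> u = 0"
    unfolding normal_conn_def
  proof (rule normal_part_eqI[OF u])
    have "cov (lie_bracket (\<lambda>_. a) (\<lambda>_. b) u) \<nu> u = 0"
      by (simp add: lie_bracket_def cov_deriv_def christoffel_fubini_study
          linear_0[OF has_derivative_linear[OF smooth_on_has_derivative[OF \<nu>(1) u]]]
          linear_0[OF linear_dF[OF u]] bounded_bilinear.zero_left[OF bounded_bilinear_fs_christoffel])
    then show "cov (lie_bracket (\<lambda>_. a) (\<lambda>_. b) u) \<nu> u - 0 \<in> tangent_sp F u"
      using subspace_0[OF subspace_tangent_sp[OF u]] by simp
  qed (rule subspace_0[OF subspace_normal_sp])
  then have "normal_conn fubini_study F (\<lambda>_. a) (normal_conn fubini_study F (\<lambda>_. b) \<nu>) u =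
      normal_conn fubini_study F (\<lambda>_. b) (normal_conn fubini_study F (\<lambda>_. a) \<nu>) u"
    using flat[rule_format, of "\<lambda>_. a" "\<lambda>_. b" \<nu>] \<nu>(1,2)
      smooth_on_const[OF open_W, of a] smooth_on_const[OF open_W, of b]
    by (simp add: normal_curvature_def)
  \<comment> \<open>The two correction terms with factor \<open>l\<close> agree by
    \<open>cov_commute\<close>.\<close>
  then have "fubini_study (F u) (cov a (cov b \<nu>) u) \<eta> = fubini_study (F u) (cov b (cov a \<nu>) u) \<eta>"
    using second_normal_derivative[OF \<nu>(1,2) u \<eta>n l, of a b]
      second_normal_derivative[OF \<nu>(1,2) u \<eta>n l, of b a] cov_commute[OF u, of a b] by simp
  then have "fubini_study (F u) (cov a (cov b \<nu>) u - cov b (cov a \<nu>) u) \<eta> = 0"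
    by (simp add: fubini_study_bilinear)
  then show ?thesis
    unfolding cov_cov_commutator[OF \<nu>(1) u] ab \<nu>(3) .
qed

end

section \<open>Umbilical normal vectors\<close>

text \<open>This is \<open>R(t, Jt) v\<close>. The hypotheses say that \<open>v\<close> is
  Hermitian-orthogonal to \<open>t\<close>, which kills the last two terms; the first scalar is
  \<open>-2 * \<i>\<close> times the squared length of \<open>t\<close>.\<close>

lemma fs_curvature_holomorphic_plane:
  assumes "fubini_study w v t = 0" "fubini_study w v (cplx_struct t) = 0"
  shows "(fs_hermitian w t (cplx_struct t) - fs_hermitian w (cplx_struct t) t) *s v
      + fs_hermitian w v (cplx_struct t) *s t - fs_hermitian w v t *s cplx_struct t
    = (- 2 * fubini_study w t t) *\<^sub>R cplx_struct v"
proof -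
  have "Im (fs_hermitian w t t) = 0"
    using arg_cong[OF cnj_fs_hermitian[of w t t], of Im] by simp
  then have t: "fs_hermitian w t t = of_real (fubini_study w t t)"
    by (simp add: complex_eq_iff fubini_study_eq_Re)
  have "fs_hermitian w v t = 0"
    using assms by (simp add: complex_eq_iff fubini_study_eq_Re cplx_struct_def fs_hermitian_smult_right)
  then show ?thesis
    by (simp add: cplx_struct_def fs_hermitian_smult_left fs_hermitian_smult_right t vec_eq_iff
        scaleR_conv_of_real[where 'a = complex] algebra_simps)
qed

context local_immersion
begin

lemma cplx_struct_normal_orthogonal_umbilical:
  assumes flat: "\<forall>X Y \<nu>. smooth_on W X \<and> smooth_on W Y \<and> smooth_on W \<nu> \<and>
      (\<forall>y\<in>W. \<nu> y \<in> normal_sp fubini_study F y) \<longrightarrow> normal_curvature fubini_study F X Y \<nu> u = 0"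
    and u: "u \<in> W" and \<eta>: "umbilical_normal fubini_study F u \<eta>"
    and t: "t \<in> tangent_sp F u" "cplx_struct t \<in> tangent_sp F u" "t \<noteq> 0"
    and v: "v \<in> normal_sp fubini_study F u"
  shows "fubini_study (F u) (cplx_struct v) \<eta> = 0"
proof -
  have "fubini_study (F u) v t = 0" "fubini_study (F u) v (cplx_struct t) = 0"
    using v t by (auto simp: normal_sp_def)
  note plane = fs_curvature_holomorphic_plane[OF this]
  have "fubini_study (F u) ((- 2 * fubini_study (F u) t t) *\<^sub>R cplx_struct v) \<eta> = 0"
    using ricci_umbilical[OF flat u \<eta> v t(1,2)] unfolding plane by blast
  then show ?thesis
    using t(3) by (simp add: fubini_study_bilinear fubini_study_eq_0_iff)
qed

end

lemma umbilical_normal_in_span_distinguished: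
  assumes imm: "local_immersion F W"
    and flat: "\<forall>X Y \<nu>. smooth_on W X \<and> smooth_on W Y \<and> smooth_on W \<nu> \<and>
      (\<forall>y\<in>W. \<nu> y \<in> normal_sp fubini_study F y) \<longrightarrow> normal_curvature fubini_study F X Y \<nu> u = 0"
    and u: "u \<in> W" and H: "dim (holomorphic_tangent_sp F u) > 0"
    and \<xi>: "distinguished_normal F u \<xi>" and \<eta>: "umbilical_normal fubini_study F u \<eta>"
  shows "\<eta> \<in> span {\<xi>}"
proof -
  interpret local_immersion F W by (rule imm)
  have "\<not> holomorphic_tangent_sp F u \<subseteq> {0}"
    using H by (metis dim_eq_0 less_irrefl)
  then obtain t where t: "t \<in> tangent_sp F u" "cplx_struct t \<in> tangent_sp F u" "cplx_struct t \<noteq> 0"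
    by (auto simp: holomorphic_tangent_sp_def)
  then have "t \<noteq> 0"
    by (auto simp: cplx_struct_def)
  note J_orth = cplx_struct_normal_orthogonal_umbilical[OF flat u \<eta> t(1,2) this]
  have \<xi>n: "\<xi> \<in> normal_sp fubini_study F u" "fubini_study (F u) \<xi> \<xi> = 1"
    using \<xi> by (auto simp: distinguished_normal_def)
  have \<eta>n: "\<eta> \<in> normal_sp fubini_study F u"
    using \<eta> by (simp add: umbilical_normal_def)
  \<comment> \<open>The component of \<open>\<eta>\<close> orthogonal to \<open>\<xi>\<close>; the
    coefficient is right because \<open>\<xi>\<close> has unit length.\<close>
  define \<eta>' where "\<eta>' = \<eta> - fubini_study (F u) \<eta> \<xi> *\<^sub>R \<xi>"
  have \<eta>'n: "\<eta>' \<in> normal_sp fubini_study F u"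
    unfolding \<eta>'_def by (intro subspace_diff[OF subspace_normal_sp] subspace_scale[OF subspace_normal_sp] \<xi>n \<eta>n)
  have \<eta>'_\<xi>: "fubini_study (F u) \<eta>' \<xi> = 0"
    by (simp add: \<eta>'_def fubini_study_bilinear \<xi>n(2))
  \<comment> \<open>\<open>J\<close> is skew, and \<open>J s\<close> is a tangent vector plus a
    multiple of \<open>\<xi>\<close>, both orthogonal to \<open>\<eta>'\<close>.\<close>
  have "fubini_study (F u) (cplx_struct \<eta>') s = 0" if s: "s \<in> tangent_sp F u" for s
  proof -
    obtain r k where "cplx_struct s = r + k *\<^sub>R \<xi>" "r \<in> tangent_sp F u"
      using s \<xi> by (auto simp: distinguished_normal_def span_singleton)
    then show ?thesis
      using \<eta>'n \<eta>'_\<xi> by (simp add: fubini_study_J_left normal_sp_def fubini_study_bilinear)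
  qed
  then have "cplx_struct \<eta>' \<in> normal_sp fubini_study F u"
    by (simp add: normal_sp_def)
  \<comment> \<open>Applied to the normal vector \<open>J \<eta>'\<close>, where
    \<open>J (J \<eta>')\<close> is \<open>- \<eta>'\<close>.\<close>
  from J_orth[OF this] have "fubini_study (F u) \<eta>' \<eta> = 0"
    by (simp add: cplx_struct_cplx_struct fubini_study_bilinear)
  moreover have "fubini_study (F u) \<eta>' \<eta>' = fubini_study (F u) \<eta>' \<eta>"
    by (subst (2) \<eta>'_def) (simp add: fubini_study_bilinear \<eta>'_\<xi>)
  ultimately have "\<eta>' = 0"
    by (simp add: fubini_study_eq_0_iff)
  then have "\<eta> = fubini_study (F u) \<eta> \<xi> *\<^sub>R \<xi>"
    by (simp add: \<eta>'_def)
  then show ?thesis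
    unfolding span_singleton by blast
qed

theorem theorem1p1:
  fixes M :: "'a topology"
    and \<A> :: "('a, real ^ 'n) chart set"
    and f :: "'a \<Rightarrow> (complex ^ ('m::finite) option) set"
    and p :: nat
    and x :: 'a
    and c :: "('a, real ^ 'n) chart"
    and d :: "((complex ^ ('m::finite) option) set, complex ^ 'm) chart"
    and \<xi> \<eta> :: "complex ^ 'm"
  assumes "CARD('n) > 2"
    and "p \<ge> 1"
    and "CARD('n) + p = 2 * CARD('m)"
    and "smooth_manifold M \<A>"
    and "smooth_immersion \<A> affine_atlas f"
    and "max_CR_dim \<A> f"
    and "flat_normal_connection \<A> f"
    and "x \<in> topspace M"
    and "c \<in> \<A>" and "x \<in> fst c"
    and "d \<in> affine_atlas" and "f x \<in> fst d"
    and "distinguished_normal (coord_rep c d f) (snd c x) \<xi>"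
    and "umbilical_normal fubini_study (coord_rep c d f) (snd c x) \<eta>"
  shows "\<eta> \<in> span {\<xi>}"
proof -
  define F where "F = coord_rep c d f"
  define W where "W = coord_dom c d f"
  have imm: "local_immersion F W"
    using assms(5,9,11) unfolding smooth_immersion_def F_def W_def by unfold_locales blast+
  have u: "snd c x \<in> W"
    unfolding W_def coord_dom_def using assms(10,12) by blast
  \<comment> \<open>Flatness is used with the whole coordinate domain as the open set.\<close>
  have flat: "\<forall>X Y \<nu>. smooth_on W X \<and> smooth_on W Y \<and> smooth_on W \<nu> \<and>
      (\<forall>y\<in>W. \<nu> y \<in> normal_sp fubini_study F y) \<longrightarrow> normal_curvature fubini_study F X Y \<nu> (snd c x) = 0"
    using assms(7,9,11) u local_immersion.open_W[OF imm]
    unfolding flat_normal_connection_def F_def W_def by blast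
  \<comment> \<open>The dimension is \<open>CARD('n) - 1\<close>, positive since
    \<open>CARD('n) > 2\<close>.\<close>
  have H: "dim (holomorphic_tangent_sp F (snd c x)) > 0"
    using assms(1,6,9,11) u unfolding max_CR_dim_def F_def W_def by auto
  show ?thesis
    by (rule umbilical_normal_in_span_distinguished[OF imm flat u H assms(13,14)[folded F_def]])
qed

end
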